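(* Let $s\ge 0$, let $k_1,\dots,k_{s+1}$ be positive integers and let $r_1,\dots,r_s\in\{\mathsf{u},\mathsf{d},\mathsf{o},\mathsf{c}\}$ be such that $r_1\cdots r_s$ is proper and $k_1r_1\cdots k_sr_sk_{s+1}$ is admissible. Then \[ \zeta(k_1r_1\cdots k_sr_sk_{s+1})=I\Big(P\big(\bullet\{\mathsf{u}\circ\}^{k_1-1}\,r_1\,\bullet\{\mathsf{u}\circ\}^{k_2-1}\,r_2\cdots\bullet\{\mathsf{u}\circ\}^{k_s-1}\,r_s\,\bullet\{\mathsf{u}\circ\}^{k_{s+1}-1}\big)\Big). \]
   Context: Symbols and weights: $\mathsf{u},\mathsf{d},\mathsf{o},\mathsf{c}$ are four formal symbols with $E(\mathsf{u})=E(\mathsf{d})=0$, $E(\mathsf{o})=1$, $E(\mathsf{c})=-1$, and $E(r_1\cdots r_s)=E(r_1)+\cdots+E(r_s)$. A sequence $r_1\cdots r_s$ is weakly proper if $E(r_1\cdots r_j)\ge 0$ for all $1\le j\le s$, and proper if moreover $E(r_1\cdots r_s)=0$. Lattice sets: for weakly proper $r_1\cdots r_s$ put $L(r_1,\dots,r_s)=\{(x,y)\in\mathbb{Z}^2: 1\le x\le s+1,\ y\in Y_x\}$, where $Y_1=\{0\}$ and, writing $Y^{\pm}=\{y\pm1:y\in Y\}$, $Y_{x+1}=Y_x^+$ if $r_x=\mathsf{u}$, $Y_x^-$ if $r_x=\mathsf{d}$, $Y_x^+\cup Y_x^-$ if $r_x=\mathsf{o}$, $Y_x^+\cap Y_x^-$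 if $r_x=\mathsf{c}$. Admissibility and zeta values: for positive integers $k_i$ and proper $r_1\cdots r_s$, the string $k_1r_1\cdots k_sr_sk_{s+1}$ is admissible if $k_i>1$ for every $i$ with ($i=1$ or $r_{i-1}\in\{\mathsf{u},\mathsf{o}\}$) and ($i=s+1$ or $r_i\in\{\mathsf{d},\mathsf{c}\}$). Then, with $L=L(r_1,\dots,r_s)$, \[ \zeta(k_1r_1\cdots k_sr_sk_{s+1})=\sum_{(m_p)_{p\in L}}\prod_{(x,y)\in L}\frac{1}{m_{(x,y)}^{k_x}}, \] the sum over all $(m_p)_{p\in L}\in\mathbb{N}^L$ ($\mathbb{N}=\{1,2,\dots\}$) such that $m_{(x,y)}<m_{(x+1,y+1)}$ whenever both $(x,y),(x+1,y+1)\in L$ and $m_{(x,y)}\ge m_{(x+1,y-1)}$ whenever both $(x,y),(x+1,y-1)\in L$. (These are exactly the Schur multiple zeta values of connected skew Young diagrams whose index is constant along diagonals.) Labelled posets and integrals: for $d_1,\dots,d_{N+1}\in\{\circ,\bullet\}$ and weakly proper $r_1\cdots r_N$, $P(d_1r_1\cdots d_Nr_Nd_{N+1})$ is the set $X=L(r_1,\dots,r_N)$ with the partial order generated by $(x,y)\le(x+1,y+1)$ and $(x+1,y-1)\le(x,y)$ (for elements of $X$), together with the labelling $\delta_X(x,y)=d_x$. For such a labelled finite poset, $I(X)=\int_{\Delta}\prod_{p\in X}\omega_{\delta_X(p)}(t_p)$, where $\Delta=\{(t_p)_{p\in X}\in[0,1]^X: t_p<t_q \text{ whenever } p<q\}$,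 $\omega_\circ(t)=dt/t$ and $\omega_\bullet(t)=dt/(1-t)$. The word inside $P$: $\{\mathsf{u}\circ\}^{l}$ denotes $l$ repetitions of $\mathsf{u}\circ$; so the displayed word alternates labels and symbols, begins and ends with a label, and its symbol sequence is obtained from $r_1\cdots r_s$ by inserting extra $\mathsf{u}$'s (hence it is again proper). *)

theory Defs
  imports "HOL-Analysis.Analysis"
begin

text \<open>The symbols $\mathsf{u}, \mathsf{d}, \mathsf{o}, \mathsf{c}$ in this order.\<close>

datatype step = Up | Down | Op | Cl

primrec step_weight :: "step \<Rightarrow> int" where
  "step_weight Up = 0"
| "step_weight Down = 0"
| "step_weight Op = 1"
| "step_weight Cl = -1"

definition E :: "step list \<Rightarrow> int" where
  "E rs = (\<Sum>r\<leftarrow>rs. step_weight r)"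

definition weakly_proper :: "step list \<Rightarrow> bool" where
  "weakly_proper rs \<longleftrightarrow> (\<forall>j\<in>{1..length rs}. 0 \<le> E (take j rs))"

definition proper :: "step list \<Rightarrow> bool" where
  "proper rs \<longleftrightarrow> weakly_proper rs \<and> E rs = 0"

abbreviation (input) shift_up :: "int set \<Rightarrow> int set" where
  "shift_up Y \<equiv> (\<lambda>y. y + 1) ` Y"

abbreviation (input) shift_down :: "int set \<Rightarrow> int set" where
  "shift_down Y \<equiv> (\<lambda>y. y - 1) ` Y"

primrec next_column :: "step \<Rightarrow> int set \<Rightarrow> int set" where
  "next_column Up Y = shift_up Y"
| "next_column Down Y = shift_down Y"
| "next_column Op Y = shift_up Y \<union> shift_down Y"
| "next_column Cl Y = shift_up Y \<inter> shift_down Y"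

text \<open>Lists are indexed from 0: the symbol $r_i$ is \<open>rs ! (i - 1)\<close> and $k_i$ is
  \<open>ks ! (i - 1)\<close>. Likewise \<open>column rs n\<close> is the set $Y_{n+1}$.\<close>

primrec column :: "step list \<Rightarrow> nat \<Rightarrow> int set" where
  "column rs 0 = {0}"
| "column rs (Suc n) = next_column (rs ! n) (column rs n)"

text \<open>First coordinates are at least 1, so they are taken in \<open>nat\<close>.\<close>

definition L :: "step list \<Rightarrow> (nat \<times> int) set" where
  "L rs = {(x, y). 1 \<le> x \<and> x \<le> length rs + 1 \<and> y \<in> column rs (x - 1)}"

definition admissible :: "nat list \<Rightarrow> step list \<Rightarrow> bool" where
  "admissible ks rs \<longleftrightarrow>
     (\<forall>i\<in>{1..length rs + 1}.
        (i = 1 \<or> rs ! (i - 2) \<in> {Up, Op}) \<and>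
        (i = length rs + 1 \<or> rs ! (i - 1) \<in> {Down, Cl}) \<longrightarrow> ks ! (i - 1) > 1)"

definition zeta_index :: "step list \<Rightarrow> (nat \<times> int \<Rightarrow> nat) set" where
  "zeta_index rs = {m \<in> L rs \<rightarrow>\<^sub>E {1..}.
     (\<forall>x y. (x, y) \<in> L rs \<and> (x + 1, y + 1) \<in> L rs \<longrightarrow> m (x, y) < m (x + 1, y + 1)) \<and>
     (\<forall>x y. (x, y) \<in> L rs \<and> (x + 1, y - 1) \<in> L rs \<longrightarrow> m (x, y) \<ge> m (x + 1, y - 1))}"

definition zeta_term :: "nat list \<Rightarrow> step list \<Rightarrow> (nat \<times> int \<Rightarrow> nat) \<Rightarrow> real" where
  "zeta_term ks rs m = (\<Prod>(x, y)\<in>L rs. 1 / real (m (x, y)) ^ (ks ! (x - 1)))"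

text \<open>\<open>infsum\<close> and the Bochner integral are 0 in the divergent case, so convergence of the
  series (and below of the integral) has its own predicate.\<close>

definition zeta_converges :: "nat list \<Rightarrow> step list \<Rightarrow> bool" where
  "zeta_converges ks rs \<longleftrightarrow> zeta_term ks rs summable_on zeta_index rs"

definition zeta :: "nat list \<Rightarrow> step list \<Rightarrow> real" where
  "zeta ks rs = (\<Sum>\<^sub>\<infinity>m\<in>zeta_index rs. zeta_term ks rs m)"

datatype mark = White | Black

text \<open>\<open>White\<close> and \<open>Black\<close> are the labels $\circ$ and $\bullet$;
  \<open>order\<close> is the reflexive order \<open>\<le>\<close> on \<open>elems\<close>.\<close>

record 'a labelled_poset =
  elems :: "'a set"
  order :: "'a rel"
  mark :: "'a \<Rightarrow> mark"

primrec form_density :: "mark \<Rightarrow> real \<Rightarrow> real" where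
  "form_density White t = 1 / t"
| "form_density Black t = 1 / (1 - t)"

definition Delta :: "'a labelled_poset \<Rightarrow> ('a \<Rightarrow> real) set" where
  "Delta X = {t \<in> elems X \<rightarrow>\<^sub>E {0..1}.
     \<forall>p\<in>elems X. \<forall>q\<in>elems X. (p, q) \<in> order X \<and> p \<noteq> q \<longrightarrow> t p < t q}"

definition integrand :: "'a labelled_poset \<Rightarrow> ('a \<Rightarrow> real) \<Rightarrow> real" where
  "integrand X t = (\<Prod>p\<in>elems X. form_density (mark X p) (t p))"

definition I_converges :: "'a labelled_poset \<Rightarrow> bool" where
  "I_converges X \<longleftrightarrow> set_integrable (Pi\<^sub>M (elems X) (\<lambda>_. lborel)) (Delta X) (integrand X)"

definition I :: "'a labelled_poset \<Rightarrow> real" where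
  "I X = set_lebesgue_integral (Pi\<^sub>M (elems X) (\<lambda>_. lborel)) (Delta X) (integrand X)"

definition covers :: "step list \<Rightarrow> (nat \<times> int) rel" where
  "covers rs =
     {((x, y), (x + 1, y + 1)) | x y. (x, y) \<in> L rs \<and> (x + 1, y + 1) \<in> L rs} \<union>
     {((x + 1, y - 1), (x, y)) | x y. (x, y) \<in> L rs \<and> (x + 1, y - 1) \<in> L rs}"

text \<open>The alternating word $d_1 r_1 \cdots d_N r_N d_{N+1}$ is given by its list of labels
  and its list of symbols.\<close>

definition P :: "mark list \<Rightarrow> step list \<Rightarrow> (nat \<times> int) labelled_poset" where
  "P ds rs = \<lparr>elems = L rs, order = (covers rs)\<^sup>* \<inter> L rs \<times> L rs,
     mark = (\<lambda>(x, y). ds ! (x - 1))\<rparr>"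

text \<open>Labels and symbols of the word
  $\bullet\{\mathsf{u}\circ\}^{k_1-1} r_1 \cdots \bullet\{\mathsf{u}\circ\}^{k_s-1} r_s
   \bullet\{\mathsf{u}\circ\}^{k_{s+1}-1}$. As \<open>map2\<close> truncates to the shorter list,
  the last block is appended separately in \<open>word_steps\<close>.\<close>

definition word_marks :: "nat list \<Rightarrow> mark list" where
  "word_marks ks = concat (map (\<lambda>k. Black # replicate (k - 1) White) ks)"

definition word_steps :: "nat list \<Rightarrow> step list \<Rightarrow> step list" where
  "word_steps ks rs =
     concat (map2 (\<lambda>k r. replicate (k - 1) Up @ [r]) ks rs) @ replicate (last ks - 1) Up"

end

theory Submission
  imports Defs "Jordan_Normal_Form.Determinant"
begin

text \<open>
  Both sides are evaluated one column at a time. After the integration over all columns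
  before a column $t_1<\dots<t_n$ of the poset, the density in $t$ is a combination
  of the determinants $\det(m_jt_i^{m_j-1})$ with $m_1<\dots<m_n$, whose coefficients are the partial
  sums of the zeta series. Indeed, passing to the next column means integrating each row over an
  interval between neighbouring new variables, which gives the determinant of differences
  $t_{i}^{m_j}-t_{i-1}^{m_j}$. Row and column operations turn it into a determinant of differences
  $t_i^{m_j}-t_i^{m_{j+1}}$ in the other direction, with boundary values $0$ and $\infty$ for the exponents.
  Dividing by $\prod_i t_i$ (label $\circ$) raises the exponents $k$ by one; dividing by
  $\prod_i(1-t_i)$ (label $\bullet$) produces geometric sums over $m_j<l\le m_{j+1}$, which are the
  next column of the series.
\<close>

subsection \<open>Determinants and generalised Vandermonde matrices\<close>

text \<open>Determinants appear because adjacent columns constrain each other only through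
  interlacing: once one of them is fixed, the variables of the other range over independent
  intervals. A determinant is then integrated row by row, or summed column by column, and remains a
  determinant. The strict \<open><\<close> upwards against \<open>\<ge>\<close> downwards in the
  series makes the summation ranges half-open, which is the form of a telescoping geometric sum. The
  obstacle is convergence. Initial parts of the word belong to strings that need not be admissible,
  so their integrals may be infinite. Every interchange is therefore carried out in
  \<open>ennreal\<close>, and for this the generalised Vandermonde determinants must be known to be
  nonnegative. Convergence of the series is derived separately from admissibility; the finiteness of
  the integral follows from the equality. A proper word ends in a column with a single point, where
  the remaining factor m t^(m-1) has integral 1 over the unit interval.\<close>

definition fun_det :: "nat \<Rightarrow> (nat \<Rightarrow> nat \<Rightarrow> real) \<Rightarrow> real" where
  "fun_det n f = Determinant.det (Matrix.mat n n (\<lambda>(i, j). f i j))"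

lemma permutes_atLeastLessThan_less: "p permutes {0..<n} \<Longrightarrow> i < n \<Longrightarrow> p i < n" for n :: nat
  using permutes_in_image[of p "{0..<n}" i] by simp

lemma fun_det_leibniz:
  "fun_det n f = (\<Sum>p | p permutes {0..<n}. signof p * (\<Prod>i = 0..<n. f i (p i)))"
  unfolding fun_det_def
  by (subst det_def'[of _ n]) (auto intro!: sum.cong prod.cong simp: permutes_atLeastLessThan_less)

lemma fun_det_cong: "(\<And>i j. i < n \<Longrightarrow> j < n \<Longrightarrow> f i j = g i j) \<Longrightarrow> fun_det n f = fun_det n g"
  unfolding fun_det_def by (intro arg_cong[where f = Determinant.det]) (auto intro!: eq_matI)

lemma fun_det_0 [simp]: "fun_det 0 f = 1"
  by (simp add: fun_det_leibniz)

lemma fun_det_transpose: "fun_det n (\<lambda>i j. f j i) = fun_det n f"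
proof -
  have "Matrix.transpose_mat (Matrix.mat n n (\<lambda>(i, j). f i j)) = Matrix.mat n n (\<lambda>(i, j). f j i)"
    by (auto intro!: eq_matI)
  then show ?thesis
    unfolding fun_det_def using Determinant.det_transpose[of "Matrix.mat n n (\<lambda>(i, j). f i j)" n] by simp
qed

lemma fun_det_scale_rows: "fun_det n (\<lambda>i j. c i * f i j) = (\<Prod>i<n. c i) * fun_det n f"
  unfolding fun_det_leibniz
  by (simp add: sum_distrib_left prod.distrib lessThan_atLeast0 mult_ac)

lemma fun_det_scale_cols: "fun_det n (\<lambda>i j. c j * f i j) = (\<Prod>j<n. c j) * fun_det n f"
  using fun_det_scale_rows[of n c "\<lambda>i j. f j i"] fun_det_transpose[of n "\<lambda>i j. c j * f i j"] fun_det_transpose[of n f]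
  by simp

lemma fun_det_mult: "fun_det n (\<lambda>i j. \<Sum>k<n. f i k * g k j) = fun_det n f * fun_det n g"
proof -
  have "Matrix.mat n n (\<lambda>(i, j). f i j) * Matrix.mat n n (\<lambda>(i, j). g i j)
      = Matrix.mat n n (\<lambda>(i, j). \<Sum>k<n. f i k * g k j)"
    by (auto intro!: eq_matI simp: scalar_prod_def lessThan_atLeast0 Matrix.row_def Matrix.col_def)
  then show ?thesis
    unfolding fun_det_def
    using Determinant.det_mult[of "Matrix.mat n n (\<lambda>(i, j). f i j)" n "Matrix.mat n n (\<lambda>(i, j). g i j)"]
    by simp
qed

lemma fun_det_lower_unitriangular:
  assumes "\<And>i. i < n \<Longrightarrow> f i i = 1" and "\<And>i j. i < j \<Longrightarrow> j < n \<Longrightarrow> f i j = 0"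
  shows "fun_det n f = 1"
  unfolding fun_det_def
  by (subst Determinant.det_lower_triangular[of n])
    (use assms in \<open>auto simp: prod_list_diag_prod intro!: prod.neutral\<close>)

lemma fun_det_last_column:
  assumes "\<And>i. i < n \<Longrightarrow> f i n = 0" and "f n n = 1"
  shows "fun_det (Suc n) f = fun_det n f"
proof -
  have "Matrix.mat (Suc n) (Suc n) (\<lambda>(i, j). f i j)
      = four_block_mat (Matrix.mat n n (\<lambda>(i, j). f i j)) (0\<^sub>m n 1) (Matrix.mat 1 n (\<lambda>(i, j). f n j)) (1\<^sub>m 1)"
    using assms by (auto intro!: eq_matI simp: less_Suc_eq)
  then show ?thesis
    unfolding fun_det_def by (simp add: Determinant.det_four_block_mat_upper_right_zero_col[where n = n])
qed

lemma fun_det_first_column: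
  assumes "\<And>i. 0 < i \<Longrightarrow> i \<le> n \<Longrightarrow> f i 0 = 0" and "f 0 0 = 1"
  shows "fun_det (Suc n) f = fun_det n (\<lambda>i j. f (Suc i) (Suc j))"
proof -
  have "Matrix.mat (Suc n) (Suc n) (\<lambda>(i, j). f i j)
      = four_block_mat (1\<^sub>m 1) (Matrix.mat 1 n (\<lambda>(i, j). f 0 (Suc j))) (0\<^sub>m n 1)
          (Matrix.mat n n (\<lambda>(i, j). f (Suc i) (Suc j)))"
    using assms by (auto intro!: eq_matI simp: less_Suc_eq_0_disj)
  then show ?thesis
    unfolding fun_det_def by (simp add: Determinant.det_four_block_mat_lower_left_zero_col[where n = n])
qed

text \<open>The row operation is left multiplication by the unitriangular matrix \<open>?T\<close>
  with entries -1 just below the diagonal. Row 0 keeps its value, which amounts to a preceding row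
  of zeros.\<close>

lemma fun_det_row_differences:
  "fun_det n (\<lambda>i j. f i j - (if i = 0 then 0 else f (i - 1) j)) = fun_det n f"
proof -
  let ?T = "\<lambda>i k. (if i = k then 1 else if i = Suc k then -1 else 0) :: real"
  have "fun_det n (\<lambda>i j. f i j - (if i = 0 then 0 else f (i - 1) j))
      = fun_det n (\<lambda>i j. \<Sum>k<n. ?T i k * f k j)"
  proof (rule fun_det_cong)
    fix i j assume "i < n" "j < n"
    have "(\<Sum>k<n. ?T i k * f k j) = (\<Sum>k\<in>(if i = 0 then {i} else {i, i - 1}). ?T i k * f k j)"
      using \<open>i < n\<close> by (intro sum.mono_neutral_right) auto
    then show "f i j - (if i = 0 then 0 else f (i - 1) j) = (\<Sum>k<n. ?T i k * f k j)"
      by (cases i) auto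
  qed
  also have "\<dots> = fun_det n ?T * fun_det n f"
    by (rule fun_det_mult)
  also have "fun_det n ?T = 1"
    by (rule fun_det_lower_unitriangular) auto
  finally show ?thesis by simp
qed

text \<open>In the bordered matrix, subtracting from each row its predecessor turns the column of
  ones into the first unit vector, and expansion along it leaves the smaller determinant.\<close>

lemma fun_det_row_differences_ones:
  "fun_det n (\<lambda>i j. f (Suc i) j - f i j) = fun_det (Suc n) (\<lambda>i j. if j = 0 then 1 else f i (j - 1))"
proof -
  let ?g = "\<lambda>i j. if j = 0 then 1 else f i (j - 1)"
  have "fun_det (Suc n) ?g = fun_det (Suc n) (\<lambda>i j. ?g i j - (if i = 0 then 0 else ?g (i - 1) j))"
    by (rule fun_det_row_differences[symmetric])
  also have "\<dots> = fun_det n (\<lambda>i j. f (Suc i) j - f i j)"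
    by (subst fun_det_first_column) auto
  finally show ?thesis by simp
qed

text \<open>Right multiplication by \<open>?T\<close> subtracts from each column its successor. The
  bottom row of ones becomes the last unit vector, and expansion along it removes the last row and
  column.\<close>

lemma fun_det_column_differences_ones:
  "fun_det n (\<lambda>i j. f i j - f i (Suc j)) = fun_det (Suc n) (\<lambda>i j. if i = n then 1 else f i j)"
proof -
  let ?g = "\<lambda>i j. if i = n then 1 else f i j"
  let ?T = "\<lambda>k j. (if k = j then 1 else if k = Suc j then -1 else 0) :: real"
  have "fun_det (Suc n) ?g = fun_det (Suc n) ?g * fun_det (Suc n) ?T"
    by (subst (2) fun_det_lower_unitriangular) auto
  also have "\<dots> = fun_det (Suc n) (\<lambda>i j. \<Sum>k<Suc n. ?g i k * ?T k j)"
    by (rule fun_det_mult[symmetric])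
  also have "\<dots> = fun_det (Suc n) (\<lambda>i j. if j = n then ?g i j else ?g i j - ?g i (Suc j))"
  proof (rule fun_det_cong)
    fix i j assume "i < Suc n" "j < Suc n"
    have "(\<Sum>k<Suc n. ?g i k * ?T k j) = (\<Sum>k\<in>(if j = n then {j} else {j, Suc j}). ?g i k * ?T k j)"
      using \<open>j < Suc n\<close> by (intro sum.mono_neutral_right) auto
    then show "(\<Sum>k<Suc n. ?g i k * ?T k j) = (if j = n then ?g i j else ?g i j - ?g i (Suc j))"
      by auto
  qed
  also have "\<dots> = fun_det (Suc n) (\<lambda>j i. if j = n then ?g i j else ?g i j - ?g i (Suc j))"
    by (rule fun_det_transpose[symmetric])
  also have "\<dots> = fun_det n (\<lambda>j i. f i j - f i (Suc j))"
    by (subst fun_det_last_column) (auto intro: fun_det_cong)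
  also have "\<dots> = fun_det n (\<lambda>i j. f i j - f i (Suc j))"
    by (rule fun_det_transpose)
  finally show ?thesis by simp
qed

text \<open>Each product in the Leibniz formula contains every row, hence every variable, exactly
  once, so it integrates factor by factor. The bijection \<open>e\<close> numbers the coordinates,
  because the variables are later indexed by lattice points. The measure is arbitrary so that sums,
  as integrals for the counting measure, are covered by the column version.\<close>

lemma fun_det_integral_rows:
  assumes N: "sigma_finite_measure N" and e: "bij_betw e {..<n} C"
    and F: "\<And>i j. i < n \<Longrightarrow> j < n \<Longrightarrow> integrable N (F i j)"
  shows "has_bochner_integral (Pi\<^sub>M C (\<lambda>_. N)) (\<lambda>x. fun_det n (\<lambda>i j. F i j (x (e i))))
           (fun_det n (\<lambda>i j. integral\<^sup>L N (F i j)))"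
proof -
  interpret sigma_finite_measure N by fact
  interpret product_sigma_finite "\<lambda>_. N" ..
  have [simp]: "finite C"
    using e bij_betw_finite by blast
  define d where "d = inv_into {..<n} e"
  have d: "d c < n" if "c \<in> C" for c
    using that e unfolding d_def by (metis bij_betwE bij_betw_inv_into lessThan_iff)
  have de: "d (e i) = i" if "i < n" for i
    using that e unfolding d_def by (simp add: bij_betw_inv_into_left)
  have reindex: "(\<Prod>i = 0..<n. G i (e i)) = (\<Prod>c\<in>C. G (d c) c)" for G :: "nat \<Rightarrow> _ \<Rightarrow> real"
    unfolding lessThan_atLeast0[symmetric] prod.reindex_bij_betw[OF e, symmetric] by (intro prod.cong) (auto simp: de)
  have "has_bochner_integral (Pi\<^sub>M C (\<lambda>_. N)) (\<lambda>x. signof p * (\<Prod>i = 0..<n. F i (p i) (x (e i))))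
          (signof p * (\<Prod>i = 0..<n. integral\<^sup>L N (F i (p i))))" if p: "p permutes {0..<n}" for p
  proof (rule has_bochner_integral_mult_right)
    have int: "integrable N (F (d c) (p (d c)))" if "c \<in> C" for c
      by (intro F d that permutes_atLeastLessThan_less[OF p])
    have "integrable (Pi\<^sub>M C (\<lambda>_. N)) (\<lambda>x. \<Prod>c\<in>C. F (d c) (p (d c)) (x c))"
      by (rule product_integrable_prod) (use int in auto)
    moreover have "(\<integral>x. (\<Prod>c\<in>C. F (d c) (p (d c)) (x c)) \<partial>Pi\<^sub>M C (\<lambda>_. N))
        = (\<Prod>c\<in>C. integral\<^sup>L N (F (d c) (p (d c))))"
      by (rule product_integral_prod) (use int in auto)
    ultimately show "has_bochner_integral (Pi\<^sub>M C (\<lambda>_. N)) (\<lambda>x. \<Prod>i = 0..<n. F i (p i) (x (e i)))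
        (\<Prod>i = 0..<n. integral\<^sup>L N (F i (p i)))"
      using reindex[of "\<lambda>i c. F i (p i) (x c)" for x] reindex[of "\<lambda>i _. integral\<^sup>L N (F i (p i))"]
      by (simp add: has_bochner_integral_iff)
  qed
  then show ?thesis
    unfolding fun_det_leibniz by (intro has_bochner_integral_sum) auto
qed

lemma fun_det_integral_columns:
  assumes N: "sigma_finite_measure N" and e: "bij_betw e {..<n} C"
    and F: "\<And>i j. i < n \<Longrightarrow> j < n \<Longrightarrow> integrable N (F i j)"
  shows "has_bochner_integral (Pi\<^sub>M C (\<lambda>_. N)) (\<lambda>x. fun_det n (\<lambda>i j. F i j (x (e j))))
           (fun_det n (\<lambda>i j. integral\<^sup>L N (F i j)))"
  using fun_det_integral_rows[OF N e, of "\<lambda>i j. F j i"] F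
    fun_det_transpose[of n "\<lambda>i j. F i j (x (e j))" for x] fun_det_transpose[of n "\<lambda>i j. integral\<^sup>L N (F i j)"]
  by simp

section \<open>Positivity of generalised Vandermonde determinants\<close>

lemma has_integral_power_box:
  fixes a b :: real
  assumes "a \<le> b"
  shows "has_bochner_integral lborel (\<lambda>x. real k * x ^ (k - 1) * indicator {a<..<b} x) (b ^ k - a ^ k)"
proof -
  have "has_bochner_integral lborel (\<lambda>x. (real k * x ^ (k - 1)) * indicator {a..b} x) (b ^ k - a ^ k)"
    using assms
    by (intro has_bochner_integral_FTC_Icc_real) (auto intro!: derivative_eq_intros continuous_intros)
  moreover have "AE x in lborel. (real k * x ^ (k - 1)) * indicator {a..b} x
      = (real k * x ^ (k - 1)) * (indicator {a<..<b} x :: real)"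
    using AE_lborel_singleton[of a] AE_lborel_singleton[of b]
    by eventually_elim (auto simp: indicator_def)
  ultimately show ?thesis
    by (subst (asm) has_bochner_integral_cong_AE) auto
qed

definition increasing :: "nat \<Rightarrow> (nat \<Rightarrow> 'a::order) \<Rightarrow> bool" where
  "increasing n t \<longleftrightarrow> (\<forall>i. Suc i < n \<longrightarrow> t i < t (Suc i))"

lemma increasing_less: "increasing n t \<Longrightarrow> i < j \<Longrightarrow> j < n \<Longrightarrow> t i < t j"
proof (induction j)
  case (Suc j)
  then have "t j < t (Suc j)" by (simp add: increasing_def)
  with Suc show ?case by (cases "i = j") (auto intro: less_trans)
qed simp

text \<open>Subtracting adjacent rows writes the determinant as an integral of a smaller one of the
  same kind over a box whose points are again increasing.\<close>

lemma vandermonde_nonneg: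
  assumes "increasing n t" "\<And>i. i < n \<Longrightarrow> 0 < t i" "increasing n m"
  shows "0 \<le> fun_det n (\<lambda>i j. t i ^ m j)"
  using assms
proof (induction n arbitrary: t m)
  case (Suc n)
  \<comment> \<open>Factoring \<open>t i ^ m 0\<close> out of row \<open>i\<close> leaves a first
    column of ones. The remaining exponents \<open>e j\<close> are positive for
    \<open>j < n\<close>, so \<open>e j - 1\<close> below is an exact subtraction.\<close>
  define e where "e j = m (Suc j) - m 0" for j
  have mono: "m 0 < m j" if "0 < j" "j < Suc n" for j
    using increasing_less[OF Suc.prems(3), of 0 j] that by simp
  have "fun_det (Suc n) (\<lambda>i j. t i ^ m j)
      = fun_det (Suc n) (\<lambda>i j. t i ^ m 0 * (if j = 0 then 1 else t i ^ e (j - 1)))"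
  proof (rule fun_det_cong)
    fix i j assume "i < Suc n" "j < Suc n"
    then show "t i ^ m j = t i ^ m 0 * (if j = 0 then 1 else t i ^ e (j - 1))"
      using mono[of j] by (auto simp: e_def simp flip: power_add)
  qed
  also have "\<dots> = (\<Prod>i<Suc n. t i ^ m 0) * fun_det n (\<lambda>i j. t (Suc i) ^ e j - t i ^ e j)"
    by (simp only: fun_det_scale_rows fun_det_row_differences_ones[of n "\<lambda>i j. t i ^ e j"])
  finally have eq: "fun_det (Suc n) (\<lambda>i j. t i ^ m j)
      = (\<Prod>i<Suc n. t i ^ m 0) * fun_det n (\<lambda>i j. t (Suc i) ^ e j - t i ^ e j)" .
  define f where "f i j x = real (e j) * x ^ (e j - 1) * indicator {t i<..<t (Suc i)} x" for i j x
  have step: "t i < t (Suc i)" if "i < n" for i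
    using Suc.prems(1) that by (simp add: increasing_def)
  have f: "has_bochner_integral lborel (f i j) (t (Suc i) ^ e j - t i ^ e j)" if "i < n" for i j
    unfolding f_def using step[OF that] by (intro has_integral_power_box) simp
  have "fun_det n (\<lambda>i j. t (Suc i) ^ e j - t i ^ e j) = fun_det n (\<lambda>i j. integral\<^sup>L lborel (f i j))"
    using f by (intro fun_det_cong) (auto simp: has_bochner_integral_iff)
  also have "\<dots> = (\<integral>x. fun_det n (\<lambda>i j. f i j (x i)) \<partial>Pi\<^sub>M {..<n} (\<lambda>_. lborel))"
  proof -
    have "bij_betw (\<lambda>i. i) {..<n} {..<n}"
      by (simp add: bij_betw_def)
    from fun_det_integral_rows[OF sigma_finite_lborel this, of f] show ?thesis
      using f by (auto simp: has_bochner_integral_iff)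
  qed
  also have "\<dots> \<ge> 0"
  proof (rule integral_nonneg_AE, rule AE_I2)
    fix x
    have "fun_det n (\<lambda>i j. f i j (x i))
        = fun_det n (\<lambda>i j. indicator {t i<..<t (Suc i)} (x i) * (real (e j) * x i ^ (e j - 1)))"
      unfolding f_def by (simp add: mult_ac)
    also have "\<dots> = (\<Prod>i<n. indicator {t i<..<t (Suc i)} (x i)) * ((\<Prod>j<n. real (e j)) * fun_det n (\<lambda>i j. x i ^ (e j - 1)))"
      by (simp only: fun_det_scale_rows fun_det_scale_cols)
    also have "\<dots> \<ge> 0"
    proof (cases "\<forall>i<n. x i \<in> {t i<..<t (Suc i)}")
      case True
      have "0 \<le> fun_det n (\<lambda>i j. x i ^ (e j - 1))"
      proof (rule Suc.IH)
        \<comment> \<open>Neighbouring intervals share the endpoint \<open>t (Suc i)\<close>, which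
          separates \<open>x i\<close> from \<open>x (Suc i)\<close>.\<close>
        show "increasing n x"
          unfolding increasing_def
        proof (intro allI impI)
          fix i assume "Suc i < n"
          then have "x i < t (Suc i)" "t (Suc i) < x (Suc i)"
            using True by (auto dest: spec[of _ i] spec[of _ "Suc i"])
          then show "x i < x (Suc i)" by simp
        qed
        show "0 < x i" if "i < n" for i
          using True that Suc.prems(2)[of i] by force
        show "increasing n (\<lambda>j. e j - 1)"
          unfolding increasing_def
        proof (intro allI impI)
          fix i assume "Suc i < n"
          then show "e i - 1 < e (Suc i) - 1"
            using Suc.prems(3) mono[of "Suc i"] by (auto simp: e_def increasing_def intro!: diff_less_mono)
        qed
      qed
      then show ?thesis
        by (simp add: prod_nonneg)
    next
      case False
      then have "(\<Prod>i<n. indicator {t i<..<t (Suc i)} (x i)) = (0 :: real)"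
        by (intro prod_zero) (auto simp: indicator_def)
      then show ?thesis by (simp only: mult_zero_left order_refl)
    qed
    finally show "0 \<le> fun_det n (\<lambda>i j. f i j (x i))" .
  qed
  finally show ?case
    using Suc.prems(2) unfolding eq by (intro mult_nonneg_nonneg prod_nonneg) (auto simp: less_imp_le)
qed simp

subsection \<open>Transition between adjacent columns\<close>

text \<open>Column entries are numbered upwards from the smallest one, in steps of 2.
  \<open>Down\<close> and \<open>Op\<close> lower the smallest entry by 1, so the upper neighbour of
  an entry gains one index; \<open>Up\<close> and \<open>Cl\<close> raise it by 1, so the index is
  kept.\<close>

primrec offset :: "step \<Rightarrow> nat" where
  "offset Up = 0" | "offset Down = 1" | "offset Op = 1" | "offset Cl = 0"

primrec next_size :: "step \<Rightarrow> nat \<Rightarrow> nat" where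
  "next_size Up n = n" | "next_size Down n = n" | "next_size Op n = Suc n" | "next_size Cl n = n - 1"

text \<open>The covering conditions between consecutive columns of sizes \<open>n\<close> and
  \<open>next_size r n\<close>, both listed by increasing second coordinate: the upper neighbour of entry
  \<open>i\<close> has index \<open>i + offset r\<close>, the lower one \<open>i + offset r - 1\<close>.\<close>

definition linked :: "('a \<Rightarrow> 'b \<Rightarrow> bool) \<Rightarrow> ('a \<Rightarrow> 'b \<Rightarrow> bool) \<Rightarrow> step \<Rightarrow> nat \<Rightarrow> (nat \<Rightarrow> 'a) \<Rightarrow> (nat \<Rightarrow> 'b) \<Rightarrow> bool" where
  "linked R1 R2 r n u v \<longleftrightarrow> (\<forall>i<n. (i + offset r < next_size r n \<longrightarrow> R1 (u i) (v (i + offset r))) \<and>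
     (0 < i + offset r \<longrightarrow> R2 (u i) (v (i + offset r - 1))))"

lemma linked_cong:
  assumes u: "\<And>i. i < n \<Longrightarrow> u i = u' i" and v: "\<And>i. i < next_size r n \<Longrightarrow> v i = v' i"
  shows "linked R1 R2 r n u v = linked R1 R2 r n u' v'"
proof -
  \<comment> \<open>A lower neighbour can be missing only at the bottom of the next column, never at
    its top. Hence \<open>linked\<close> bounds its index on one side only.\<close>
  have "i + offset r - 1 < next_size r n" if "i < n" "0 < i + offset r" for i
    using that by (cases r) auto
  then show ?thesis
    unfolding linked_def using u v by (intro all_cong conj_cong imp_cong refl) metis+
qed

text \<open>With the next column \<open>v\<close> fixed, \<open>below\<close> and
  \<open>above\<close> are the ends of the interval over which entry \<open>i\<close> of the old
  column is integrated. The ends 0 and 1 of the unit interval replace missing neighbours.\<close>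

definition above :: "step \<Rightarrow> nat \<Rightarrow> (nat \<Rightarrow> real) \<Rightarrow> nat \<Rightarrow> real" where
  "above r n v i = (if i + offset r < next_size r n then v (i + offset r) else 1)"

definition below :: "step \<Rightarrow> (nat \<Rightarrow> real) \<Rightarrow> nat \<Rightarrow> real" where
  "below r v i = (if i + offset r = 0 then 0 else v (i + offset r - 1))"

text \<open>Down and Op add an exponent $0$ in front of the sequence, and Up and Op add an
  exponent $\infty$ at its end; $x^\infty$ is read as $0$.\<close>

definition extended_power :: "step \<Rightarrow> nat \<Rightarrow> (nat \<Rightarrow> nat) \<Rightarrow> nat \<Rightarrow> real \<Rightarrow> real" where
  "extended_power r n m k x = (if k < offset r then 1 else if k - offset r < n then x ^ m (k - offset r) else 0)"

lemma fun_det_first_row: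
  assumes "\<And>j. 0 < j \<Longrightarrow> j \<le> n \<Longrightarrow> f 0 j = 0" and "f 0 0 = 1"
  shows "fun_det (Suc n) f = fun_det n (\<lambda>i j. f (Suc i) (Suc j))"
  using fun_det_first_column[of n "\<lambda>i j. f j i"] assms fun_det_transpose[of "Suc n" f]
    fun_det_transpose[of n "\<lambda>i j. f (Suc i) (Suc j)"] by simp

text \<open>Bordering by a row or a column of ones turns both sides into the same larger determinant.\<close>

lemma fun_det_transition:
  assumes m: "\<And>j. j < n \<Longrightarrow> 0 < m j" and n: "r = Cl \<Longrightarrow> 0 < n"
  shows "fun_det n (\<lambda>i j. above r n v i ^ m j - below r v i ^ m j)
       = fun_det (next_size r n) (\<lambda>i j. extended_power r n m j (v i) - extended_power r n m (Suc j) (v i))"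
proof -
  \<comment> \<open>Intervals of consecutive entries share an endpoint: that of entry
    \<open>i\<close> runs from \<open>X i\<close> to \<open>X (Suc i)\<close>. Thus the left-hand
    side becomes a determinant of row differences of a single family.\<close>
  define X where "X k = (if k + offset r = 0 then 0 else if k + offset r - 1 < next_size r n
    then v (k + offset r - 1) else 1)" for k
  define n' where "n' = next_size r n"
  let ?G = "\<lambda>i k. extended_power r n m k (v i)"
  let ?A = "\<lambda>i j. if j = 0 then 1 else X i ^ m (j - 1)"
  let ?B = "\<lambda>i j. if i = n' then 1 else ?G i j"
  have "fun_det n (\<lambda>i j. above r n v i ^ m j - below r v i ^ m j) = fun_det n (\<lambda>i j. X (Suc i) ^ m j - X i ^ m j)"
    using n by (intro fun_det_cong) (cases r; auto simp: above_def below_def X_def)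
  also have "\<dots> = fun_det (Suc n) ?A"
    by (rule fun_det_row_differences_ones[of n "\<lambda>i j. X i ^ m j"])
  also have "\<dots> = fun_det (Suc n') ?B"
  \<comment> \<open>If the lowest endpoint is 0, the first row of \<open>?A\<close> is a unit
    vector, since the exponents are positive. If an exponent infinity is appended, the last column
    of \<open>?B\<close> is a unit vector. \<open>Up\<close> requires both reductions,
    \<open>Op\<close> the second and \<open>Cl\<close> the first; for \<open>Down\<close> the two
    matrices agree at once.\<close>
  proof (cases r)
    case Up
    have "fun_det (Suc n) ?A = fun_det n (\<lambda>i j. X (Suc i) ^ m j)"
      using m by (subst fun_det_first_row) (auto simp: X_def Up)
    also have "\<dots> = fun_det n ?B"
      by (intro fun_det_cong) (auto simp: X_def Up n'_def extended_power_def)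
    also have "\<dots> = fun_det (Suc n) ?B"
      by (subst fun_det_last_column) (auto simp: Up n'_def extended_power_def)
    finally show ?thesis by (simp add: Up n'_def)
  next
    case Down
    then show ?thesis
      by (auto simp: X_def n'_def extended_power_def intro!: fun_det_cong)
  next
    case Op
    have "fun_det (Suc n) ?A = fun_det n' ?B"
      by (auto simp: X_def Op n'_def extended_power_def intro!: fun_det_cong)
    also have "\<dots> = fun_det (Suc n') ?B"
      by (subst fun_det_last_column) (auto simp: Op n'_def extended_power_def)
    finally show ?thesis .
  next
    case Cl
    then have [simp]: "n = Suc n'" using n by (simp add: n'_def)
    have "fun_det (Suc n) ?A = fun_det n (\<lambda>i j. X (Suc i) ^ m j)"
      using m by (subst fun_det_first_row) (auto simp: X_def Cl)
    also have "\<dots> = fun_det n ?B"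
      by (intro fun_det_cong) (auto simp: X_def Cl extended_power_def)
    finally show ?thesis by simp
  qed
  also have "\<dots> = fun_det n' (\<lambda>i j. ?G i j - ?G i (Suc j))"
    by (rule fun_det_column_differences_ones[symmetric])
  finally show ?thesis by (simp add: n'_def)
qed

text \<open>The factor contributed by one column: $\det(t_i^{m_j-1})\prod_j m_j$. Its nonnegativity
  allows all interchanges of sums and integrals by Tonelli's theorem, before convergence is known.\<close>

definition kernel :: "nat \<Rightarrow> (nat \<Rightarrow> real) \<Rightarrow> (nat \<Rightarrow> nat) \<Rightarrow> ennreal" where
  "kernel n t m = (if (\<forall>i<n. 0 < t i \<and> t i < 1) \<and> increasing n t
     then ennreal (fun_det n (\<lambda>i j. real (m j) * t i ^ (m j - 1))) else 0)"

lemma derivative_vandermonde_nonneg: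
  assumes "increasing n t" "\<And>i. i < n \<Longrightarrow> 0 < t i" "increasing n m" "\<And>j. j < n \<Longrightarrow> 0 < m j"
  shows "0 \<le> fun_det n (\<lambda>i j. t i ^ (m j - 1))" "0 \<le> fun_det n (\<lambda>i j. real (m j) * t i ^ (m j - 1))"
proof -
  have "increasing n (\<lambda>j. m j - 1)"
    unfolding increasing_def
  proof (intro allI impI)
    fix i assume "Suc i < n"
    then show "m i - 1 < m (Suc i) - 1"
      using assms(3) assms(4)[of i] by (auto simp: increasing_def intro!: diff_less_mono)
  qed
  then show 1: "0 \<le> fun_det n (\<lambda>i j. t i ^ (m j - 1))"
    by (intro vandermonde_nonneg assms)
  show "0 \<le> fun_det n (\<lambda>i j. real (m j) * t i ^ (m j - 1))"
    using 1 unfolding fun_det_scale_cols[of n "\<lambda>j. real (m j)"] by (simp add: prod_nonneg)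
qed

text \<open>Two consecutive entries of the new column are the lower and the upper neighbour of one
  entry of the old column, which lies between them.\<close>

lemma linked_increasing_right:
  fixes v :: "nat \<Rightarrow> 'a :: linorder"
  assumes "linked R1 R2 r n u v" and "\<And>x y z. R2 x y \<Longrightarrow> R1 x z \<Longrightarrow> y < z"
  shows "increasing (next_size r n) v"
  unfolding increasing_def
proof (intro allI impI)
  fix i assume i: "Suc i < next_size r n"
  define k where "k = Suc i - offset r"
  have "k < n" "k + offset r = Suc i"
    using i by (cases r; auto simp: k_def)+
  then show "v i < v (Suc i)"
    using assms i unfolding linked_def by (metis diff_Suc_1 zero_less_Suc)
qed

text \<open>Two consecutive entries of the old column have a common neighbour in the new column: the
  upper one of the first is the lower one of the second.\<close>

lemma linked_increasing_left:
  fixes u :: "nat \<Rightarrow> 'a :: linorder"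
  assumes "linked R1 R2 r n u v" and "\<And>x y z. R1 x y \<Longrightarrow> R2 z y \<Longrightarrow> x < z"
  shows "increasing n u"
  unfolding increasing_def
proof (intro allI impI)
  fix i assume i: "Suc i < n"
  have "i + offset r < next_size r n"
    using i by (cases r; auto)
  moreover have "R2 (u (Suc i)) (v (i + offset r))"
    using assms(1) i unfolding linked_def by (metis add_Suc diff_Suc_1 zero_less_Suc)
  ultimately show "u i < u (Suc i)"
    using assms i unfolding linked_def by (metis Suc_lessD)
qed

lemma below_le_above:
  assumes v: "\<forall>i<next_size r n. 0 < v i \<and> v i < 1" "increasing (next_size r n) v" and "i < n"
  shows "0 \<le> below r v i" "below r v i \<le> above r n v i" "above r n v i \<le> 1"
proof -
  have 1: "i + offset r - 1 < next_size r n" if "0 < i + offset r"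
    using \<open>i < n\<close> that by (cases r) auto
  have 2: "0 < v (i + offset r - 1)" "v (i + offset r - 1) < 1" if "0 < i + offset r"
    using v(1) 1[OF that] by blast+
  have 3: "0 < v (i + offset r)" "v (i + offset r) < 1" if "i + offset r < next_size r n"
    using v(1) that by blast+
  have 4: "v (i + offset r - 1) < v (i + offset r)" if "0 < i + offset r" "i + offset r < next_size r n"
    using that by (intro increasing_less[OF v(2)]) auto
  show "0 \<le> below r v i"
    using 2(1) by (cases "0 < i + offset r") (simp_all add: below_def)
  show "above r n v i \<le> 1"
    using 3(2) by (cases "i + offset r < next_size r n") (simp_all add: above_def)
  show "below r v i \<le> above r n v i"
  proof (cases "i + offset r = 0")
    case True
    then show ?thesis
      unfolding above_def below_def using 3(1) by (cases "i + offset r < next_size r n") (simp_all add: less_imp_le)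
  next
    case False
    then have pos: "0 < i + offset r" by simp
    show ?thesis
      unfolding above_def below_def if_not_P[OF False] using 2(2)[OF pos] 4[OF pos]
      by (cases "i + offset r < next_size r n") (simp_all add: less_imp_le)
  qed
qed

lemma below_less_iff:
  assumes "0 \<le> below r v i"
  shows "below r v i < x \<longleftrightarrow> 0 < x \<and> (0 < i + offset r \<longrightarrow> v (i + offset r - 1) < x)"
proof (cases "i + offset r = 0")
  case False
  then have "below r v i = v (i + offset r - 1)" "0 < i + offset r"
    by (simp_all only: below_def if_False)
  with assms show ?thesis by fastforce
qed (simp add: below_def)

lemma less_above_iff:
  assumes "above r n v i \<le> 1"
  shows "x < above r n v i \<longleftrightarrow> x < 1 \<and> (i + offset r < next_size r n \<longrightarrow> x < v (i + offset r))"
proof (cases "i + offset r < next_size r n")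
  case True
  then have "above r n v i = v (i + offset r)"
    by (simp add: above_def)
  with assms True show ?thesis by fastforce
qed (simp add: above_def)

text \<open>The conditions never compare two entries of the same column, so for fixed
  \<open>v\<close> they decouple into one interval for each \<open>u i\<close>. This product
  structure is what allows integration row by row.\<close>

lemma linked_box:
  assumes v: "\<forall>i<next_size r n. 0 < v i \<and> v i < 1" "increasing (next_size r n) v"
  shows "(\<forall>i<n. 0 < u i \<and> u i < 1) \<and> linked (<) (>) r n u v \<longleftrightarrow> (\<forall>i<n. u i \<in> {below r v i<..<above r n v i})"
proof
  assume A: "(\<forall>i<n. 0 < u i \<and> u i < 1) \<and> linked (<) (>) r n u v"
  show "\<forall>i<n. u i \<in> {below r v i<..<above r n v i}"
  proof (intro allI impI)
    fix i assume i: "i < n"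
    have 1: "0 < u i \<and> u i < 1"
      using A i by simp
    have 2: "i + offset r < next_size r n \<longrightarrow> u i < v (i + offset r)"
        "0 < i + offset r \<longrightarrow> v (i + offset r - 1) < u i"
      using A i unfolding linked_def by simp_all
    show "u i \<in> {below r v i<..<above r n v i}"
      unfolding greaterThanLessThan_iff below_less_iff[OF below_le_above(1)[OF v i]] less_above_iff[OF below_le_above(3)[OF v i]]
      using 1 2 by (intro conjI) simp_all
  qed
next
  assume A: "\<forall>i<n. u i \<in> {below r v i<..<above r n v i}"
  have B: "(0 < u i \<and> (0 < i + offset r \<longrightarrow> v (i + offset r - 1) < u i)) \<and>
      (u i < 1 \<and> (i + offset r < next_size r n \<longrightarrow> u i < v (i + offset r)))" if i: "i < n" for i
    using A[rule_format, OF i]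
    unfolding greaterThanLessThan_iff below_less_iff[OF below_le_above(1)[OF v i]] less_above_iff[OF below_le_above(3)[OF v i]] .
  show "(\<forall>i<n. 0 < u i \<and> u i < 1) \<and> linked (<) (>) r n u v"
    unfolding linked_def using B by simp
qed

text \<open>The entries \<open>real (m j) * x ^ (m j - 1)\<close> are the derivatives of
  \<open>x ^ m j\<close>, and row \<open>i\<close> is integrated over its own interval by the
  fundamental theorem. If \<open>v\<close> is not increasing, no old column can be linked to it and
  the integral vanishes.\<close>

lemma kernel_integral:
  assumes e: "bij_betw e {..<n} C" and v: "\<forall>i<next_size r n. 0 < v i \<and> v i < 1"
    and m: "\<And>j. j < n \<Longrightarrow> 0 < m j" "increasing n m"
  shows "(\<integral>\<^sup>+x. kernel n (\<lambda>i. x (e i)) m * of_bool (linked (<) (>) r n (\<lambda>i. x (e i)) v) \<partial>Pi\<^sub>M C (\<lambda>_. lborel))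
    = (if increasing (next_size r n) v
       then ennreal (fun_det n (\<lambda>i j. above r n v i ^ m j - below r v i ^ m j)) else 0)"
proof (cases "increasing (next_size r n) v")
  case False
  then have "\<not> linked (<) (>) r n u v" for u
    using linked_increasing_right[of "(<)" "(>)" r n u v] by fastforce
  with False show ?thesis by simp
next
  case True
  define f where "f i j x = real (m j) * x ^ (m j - 1) * indicator {below r v i<..<above r n v i} x" for i j x
  have f: "has_bochner_integral lborel (f i j) (above r n v i ^ m j - below r v i ^ m j)" if "i < n" for i j
    unfolding f_def using below_le_above[OF v True that] by (intro has_integral_power_box) auto
  let ?I = "\<lambda>x. fun_det n (\<lambda>i j. f i j (x (e i)))"
  have I: "has_bochner_integral (Pi\<^sub>M C (\<lambda>_. lborel)) ?I (fun_det n (\<lambda>i j. above r n v i ^ m j - below r v i ^ m j))"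
  proof -
    have "fun_det n (\<lambda>i j. integral\<^sup>L lborel (f i j)) = fun_det n (\<lambda>i j. above r n v i ^ m j - below r v i ^ m j)"
      using f by (intro fun_det_cong) (auto simp: has_bochner_integral_iff)
    then show ?thesis
      using fun_det_integral_rows[OF sigma_finite_lborel e, of f] f by (auto simp: has_bochner_integral_iff)
  qed
  have eq: "?I x = (\<Prod>i<n. indicator {below r v i<..<above r n v i} (x (e i)))
      * fun_det n (\<lambda>i j. real (m j) * x (e i) ^ (m j - 1))" for x
    unfolding f_def fun_det_scale_rows[symmetric] by (simp add: mult_ac)
  \<comment> \<open>Inside the box the linking conditions make the coordinates increasing, so
    \<open>kernel\<close> is the plain determinant there; outside the box both sides are 0.\<close>
  have point: "kernel n (\<lambda>i. x (e i)) m * of_bool (linked (<) (>) r n (\<lambda>i. x (e i)) v) = ennreal (?I x) \<and> 0 \<le> ?I x" for x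
  proof (cases "\<forall>i<n. x (e i) \<in> {below r v i<..<above r n v i}")
    case T: True
    then have *: "\<forall>i<n. 0 < x (e i) \<and> x (e i) < 1" "linked (<) (>) r n (\<lambda>i. x (e i)) v"
      using linked_box[OF v True, of "\<lambda>i. x (e i)"] by blast+
    then have "increasing n (\<lambda>i. x (e i))"
      using linked_increasing_left by force
    moreover have "?I x = fun_det n (\<lambda>i j. real (m j) * x (e i) ^ (m j - 1))"
      unfolding eq using T by (simp add: indicator_def)
    ultimately show ?thesis
      using * derivative_vandermonde_nonneg(2)[of n "\<lambda>i. x (e i)" m] m by (simp add: kernel_def)
  next
    case F: False
    then have "(\<Prod>i<n. indicator {below r v i<..<above r n v i} (x (e i))) = (0 :: real)"
      by (intro prod_zero) (auto simp: indicator_def)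
    then have "?I x = 0"
      unfolding eq by (simp only: mult_zero_left)
    moreover have "kernel n (\<lambda>i. x (e i)) m = 0 \<or> \<not> linked (<) (>) r n (\<lambda>i. x (e i)) v"
      using linked_box[OF v True, of "\<lambda>i. x (e i)"] F by (auto simp: kernel_def)
    ultimately show ?thesis by auto
  qed
  then have "(\<integral>\<^sup>+x. kernel n (\<lambda>i. x (e i)) m * of_bool (linked (<) (>) r n (\<lambda>i. x (e i)) v) \<partial>Pi\<^sub>M C (\<lambda>_. lborel))
    = (\<integral>\<^sup>+x. ennreal (?I x) \<partial>Pi\<^sub>M C (\<lambda>_. lborel))"
    by simp
  also have "\<dots> = ennreal (fun_det n (\<lambda>i j. above r n v i ^ m j - below r v i ^ m j))"
    using I point by (subst nn_integral_eq_integral) (auto simp: has_bochner_integral_iff)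
  finally show ?thesis
    using True by simp
qed

section \<open>Summation over the next column of the series\<close>

definition inverse_power :: "nat \<Rightarrow> nat \<Rightarrow> ennreal" where
  "inverse_power k a = (if 0 < a then ennreal (1 / real a ^ k) else 0)"

text \<open>A shifted geometric series, written as an integral for the counting measure so that the
  integration of determinants column by column applies. The exponent \<open>l - 1\<close> is the one
  occurring in \<open>kernel\<close>.\<close>

lemma has_integral_geometric_tail:
  fixes x :: real
  assumes "0 < x" "x < 1"
  shows "has_bochner_integral (count_space UNIV) (\<lambda>l. x ^ (l - 1) * indicator {a<..} l) (x ^ a / (1 - x))"
proof -
  let ?f = "\<lambda>l. x ^ (l - 1) * indicator {a<..} l"
  have "(\<lambda>l. x ^ a * x ^ l) sums (x ^ a * (1 / (1 - x)))"
    using assms by (intro sums_mult geometric_sums) auto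
  then have "(\<lambda>l. ?f (l + Suc a)) sums (x ^ a / (1 - x))"
    by (simp add: power_add mult_ac)
  then have "?f sums (x ^ a / (1 - x) + (\<Sum>l<Suc a. ?f l))"
    by (subst (asm) sums_iff_shift)
  also have "(\<Sum>l<Suc a. ?f l) = 0"
    by (intro sum.neutral) auto
  finally have sums: "?f sums (x ^ a / (1 - x))" by simp
  then have "integrable (count_space UNIV) ?f"
    using assms by (simp add: integrable_count_space_nat_iff abs_mult sums_iff)
  with sums show ?thesis
    by (simp add: has_bochner_integral_iff integral_count_space_nat sums_iff)
qed

lemma has_integral_geometric_segment:
  fixes x :: real
  assumes "0 < x" "x < 1" "a \<le> b"
  shows "has_bochner_integral (count_space UNIV) (\<lambda>l. x ^ (l - 1) * indicator {a<..b} l) ((x ^ a - x ^ b) / (1 - x))"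
proof -
  have "x ^ (l - 1) * indicator {a<..b} l = x ^ (l - 1) * indicator {a<..} l - x ^ (l - 1) * indicator {b<..} l" for l
    using assms by (auto simp: indicator_def)
  then show ?thesis
    using has_bochner_integral_diff[OF has_integral_geometric_tail[of x a] has_integral_geometric_tail[of x b]] assms
    by (simp add: diff_divide_distrib)
qed

text \<open>The range of entry \<open>j\<close> of the new series column for a fixed old column
  \<open>m\<close>. The roles are opposite to those for integrals, where the new column is fixed and
  the old one varies. A missing neighbour leaves the bound 0 or infinity.\<close>

definition summation_box :: "step \<Rightarrow> nat \<Rightarrow> (nat \<Rightarrow> nat) \<Rightarrow> nat \<Rightarrow> nat set" where
  "summation_box r n m j = {l. 0 < l \<and> (offset r \<le> j \<longrightarrow> m (j - offset r) < l) \<and>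
     (Suc j - offset r < n \<longrightarrow> l \<le> m (Suc j - offset r))}"

text \<open>The sum of x^(l-1) over a < l \<le> b is (x^a - x^b) / (1 - x). A missing lower
  neighbour gives a = 0, hence the power 1, and a missing upper bound gives b = infinity, hence the
  power 0; these are the conventions of \<open>extended_power\<close>.\<close>

lemma has_integral_summation_box:
  assumes x: "0 < x" "x < 1" and m: "increasing n m" and j: "j < next_size r n"
  shows "has_bochner_integral (count_space UNIV) (\<lambda>l. x ^ (l - 1) * indicator (summation_box r n m j) l)
    ((extended_power r n m j x - extended_power r n m (Suc j) x) / (1 - x))"
proof -
  define a where "a = (if offset r \<le> j then m (j - offset r) else 0)"
  have r: "offset r \<le> 1" "offset r \<le> j \<Longrightarrow> j - offset r < n"
    using j by (cases r; simp)+
  have low: "extended_power r n m j x = x ^ a"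
    using r(2) by (auto simp: extended_power_def a_def)
  show ?thesis
  proof (cases "Suc j - offset r < n")
    case True
    have "a \<le> m (Suc j - offset r)"
      using increasing_less[OF m, of "j - offset r" "Suc j - offset r"] True by (auto simp: a_def Suc_diff_le)
    moreover have "summation_box r n m j = {a<..m (Suc j - offset r)}"
      using True by (auto simp: summation_box_def a_def)
    moreover have "extended_power r n m (Suc j) x = x ^ m (Suc j - offset r)"
      using True r by (auto simp: extended_power_def)
    ultimately show ?thesis
      using has_integral_geometric_segment[OF x] low by simp
  next
    case False
    then have "summation_box r n m j = {a<..}" "extended_power r n m (Suc j) x = 0"
      using r by (auto simp: summation_box_def a_def extended_power_def)
    then show ?thesis
      using has_integral_geometric_tail[OF x] low by simp
  qed
qed

lemma linked_summation_box:
  "(\<forall>j<next_size r n. 0 < l j) \<and> linked (<) (\<ge>) r n m l \<longleftrightarrow>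
    (\<forall>j<next_size r n. l j \<in> summation_box r n m j)"
proof -
  have "linked (<) (\<ge>) r n m l \<longleftrightarrow> (\<forall>j<next_size r n. (offset r \<le> j \<longrightarrow> m (j - offset r) < l j) \<and>
     (Suc j - offset r < n \<longrightarrow> l j \<le> m (Suc j - offset r)))"
  proof
    assume L: "linked (<) (\<ge>) r n m l"
    show "\<forall>j<next_size r n. (offset r \<le> j \<longrightarrow> m (j - offset r) < l j) \<and>
     (Suc j - offset r < n \<longrightarrow> l j \<le> m (Suc j - offset r))"
    proof (intro allI impI conjI)
      fix j assume j: "j < next_size r n"
      show "m (j - offset r) < l j" if "offset r \<le> j"
      proof -
        have "j - offset r < n" using j that by (cases r) auto
        with L that j show ?thesis unfolding linked_def by (metis le_add_diff_inverse2)
      qed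
      show "l j \<le> m (Suc j - offset r)" if "Suc j - offset r < n"
      proof -
        have "Suc j - offset r + offset r = Suc j" by (cases r) auto
        with L that show ?thesis unfolding linked_def by (metis diff_Suc_1 zero_less_Suc)
      qed
    qed
  next
    assume B: "\<forall>j<next_size r n. (offset r \<le> j \<longrightarrow> m (j - offset r) < l j) \<and>
     (Suc j - offset r < n \<longrightarrow> l j \<le> m (Suc j - offset r))"
    show "linked (<) (\<ge>) r n m l"
      unfolding linked_def
    proof (intro allI impI conjI)
      fix i assume i: "i < n"
      show "m i < l (i + offset r)" if "i + offset r < next_size r n"
        using B[rule_format, OF that] by simp
      show "m i \<ge> l (i + offset r - 1)" if pos: "0 < i + offset r"
      proof -
        have "i + offset r - 1 < next_size r n" using i pos by (cases r) auto
        with B i pos show ?thesis by force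
      qed
    qed
  qed
  then show ?thesis
    unfolding summation_box_def by auto
qed

text \<open>Each column of the determinant carries its own summation variable, and the weights
  \<open>1 / l\<close> cancel the factors \<open>l\<close> in \<open>kernel\<close>. The geometric
  sums produce differences of adjacent columns, which \<open>fun_det_transition\<close> turns back
  into the differences of rows coming from the integral over the preceding column.\<close>

lemma kernel_sum:
  assumes e: "bij_betw e {..<next_size r n} C" and v: "\<forall>i<next_size r n. 0 < v i \<and> v i < 1"
    and m: "\<And>j. j < n \<Longrightarrow> 0 < m j" "increasing n m" and n: "r = Cl \<Longrightarrow> 0 < n"
  shows "(\<integral>\<^sup>+l. (\<Prod>c\<in>C. inverse_power 1 (l c)) *
        (of_bool (linked (<) (\<ge>) r n m (\<lambda>j. l (e j))) * kernel (next_size r n) v (\<lambda>j. l (e j)))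
        \<partial>Pi\<^sub>M C (\<lambda>_. count_space UNIV))
    = (if increasing (next_size r n) v
       then (\<Prod>i<next_size r n. ennreal (1 / (1 - v i))) *
         ennreal (fun_det n (\<lambda>i j. above r n v i ^ m j - below r v i ^ m j)) else 0)"
proof (cases "increasing (next_size r n) v")
  case False
  then show ?thesis by (simp add: kernel_def)
next
  case True
  define n' where "n' = next_size r n"
  define f where "f i j l = v i ^ (l - 1) * indicator (summation_box r n m j) l" for i j and l :: nat
  let ?p = "\<lambda>i j. extended_power r n m j (v i) - extended_power r n m (Suc j) (v i)"
  have f: "has_bochner_integral (count_space UNIV) (f i j) (1 / (1 - v i) * ?p i j)" if "i < n'" "j < n'" for i j
    using has_integral_summation_box[of "v i" n m j r] v m that unfolding f_def n'_def by simp
  let ?I = "\<lambda>l. fun_det n' (\<lambda>i j. f i j (l (e j)))"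
  let ?v = "(\<Prod>i<n'. 1 / (1 - v i)) * fun_det n (\<lambda>i j. above r n v i ^ m j - below r v i ^ m j)"
  have sigma: "sigma_finite_measure (count_space (UNIV :: nat set))"
    by (rule sigma_finite_measure_count_space)
  have I: "has_bochner_integral (Pi\<^sub>M C (\<lambda>_. count_space UNIV)) ?I ?v"
  proof -
    have "fun_det n' (\<lambda>i j. integral\<^sup>L (count_space UNIV) (f i j)) = fun_det n' (\<lambda>i j. 1 / (1 - v i) * ?p i j)"
      using f by (intro fun_det_cong) (simp add: has_bochner_integral_iff)
    also have "\<dots> = (\<Prod>i<n'. 1 / (1 - v i)) * fun_det n' ?p"
      by (rule fun_det_scale_rows)
    also have "fun_det n' ?p = fun_det n (\<lambda>i j. above r n v i ^ m j - below r v i ^ m j)"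
      using fun_det_transition[of n m r v] m n by (simp add: n'_def)
    finally show ?thesis
      using fun_det_integral_columns[OF sigma e[folded n'_def], of f] f by (auto simp: has_bochner_integral_iff)
  qed
  have eq: "?I l = (\<Prod>j<n'. indicator (summation_box r n m j) (l (e j)))
      * fun_det n' (\<lambda>i j. v i ^ (l (e j) - 1))" for l
    unfolding f_def fun_det_scale_cols[symmetric] by (simp add: mult_ac)
  have point: "(\<Prod>c\<in>C. inverse_power 1 (l c)) *
      (of_bool (linked (<) (\<ge>) r n m (\<lambda>j. l (e j))) * kernel n' v (\<lambda>j. l (e j))) = ennreal (?I l) \<and> 0 \<le> ?I l" for l
  proof -
    have prod: "(\<Prod>c\<in>C. inverse_power 1 (l c)) = (\<Prod>j<n'. inverse_power 1 (l (e j)))"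
      using prod.reindex_bij_betw[OF e, of "\<lambda>c. inverse_power 1 (l c)"] by (simp add: n'_def)
    show ?thesis
    proof (cases "\<forall>j<n'. l (e j) \<in> summation_box r n m j")
      case T: True
      then have *: "\<forall>j<n'. 0 < l (e j)" "linked (<) (\<ge>) r n m (\<lambda>j. l (e j))"
        using linked_summation_box[of r n "\<lambda>j. l (e j)" m] unfolding n'_def by blast+
      have incr: "increasing n' (\<lambda>j. l (e j))"
        unfolding n'_def using *(2) by (rule linked_increasing_right) simp
      have I1: "?I l = fun_det n' (\<lambda>i j. v i ^ (l (e j) - 1))"
        unfolding eq using T by (simp add: indicator_def)
      have nn: "0 \<le> ?I l"
        unfolding I1 using derivative_vandermonde_nonneg(1)[of n' v "\<lambda>j. l (e j)"] incr * v True
        by (simp add: n'_def)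
      have "(\<Prod>c\<in>C. inverse_power 1 (l c)) = ennreal (\<Prod>j<n'. 1 / real (l (e j)))"
        unfolding prod using * by (simp add: inverse_power_def flip: prod_ennreal)
      moreover have "kernel n' v (\<lambda>j. l (e j)) = ennreal ((\<Prod>j<n'. real (l (e j))) * ?I l)"
      proof -
        have "(\<forall>i<n'. 0 < v i \<and> v i < 1) \<and> increasing n' v"
          using v True by (simp add: n'_def)
        then show ?thesis
          unfolding kernel_def I1 fun_det_scale_cols by (rule if_P)
      qed
      moreover have "(\<Prod>j<n'. 1 / real (l (e j))) * ((\<Prod>j<n'. real (l (e j))) * ?I l) = ?I l"
      proof -
        have "(\<Prod>j<n'. 1 / real (l (e j)) * real (l (e j))) = 1"
          using * by (intro prod.neutral) simp
        then show ?thesis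
          by (simp only: mult.assoc[symmetric] prod.distrib[symmetric] mult_1_left)
      qed
      ultimately show ?thesis
        using * nn by (simp add: ennreal_mult'[symmetric] prod_nonneg)
    next
      case F: False
      then have "(\<Prod>j<n'. indicator (summation_box r n m j) (l (e j))) = (0 :: real)"
        by (intro prod_zero) (auto simp: indicator_def)
      then have "?I l = 0"
        unfolding eq by (simp only: mult_zero_left)
      \<comment> \<open>The value 0 of \<open>inverse_power\<close> at 0 lets the variables range
        over all of \<open>nat\<close>: families with an entry 0 contribute nothing.\<close>
      moreover have "(\<Prod>c\<in>C. inverse_power 1 (l c)) = 0" if pos: "\<not> (\<forall>j<n'. 0 < l (e j))"
        unfolding prod using pos by (intro prod_zero) (auto simp: inverse_power_def)
      moreover have "(\<forall>j<n'. 0 < l (e j)) \<Longrightarrow> \<not> linked (<) (\<ge>) r n m (\<lambda>j. l (e j))"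
        using linked_summation_box[of r n "\<lambda>j. l (e j)" m] F unfolding n'_def by blast
      ultimately show ?thesis by fastforce
    qed
  qed
  then have "(\<integral>\<^sup>+l. (\<Prod>c\<in>C. inverse_power 1 (l c)) *
        (of_bool (linked (<) (\<ge>) r n m (\<lambda>j. l (e j))) * kernel n' v (\<lambda>j. l (e j))) \<partial>Pi\<^sub>M C (\<lambda>_. count_space UNIV))
      = (\<integral>\<^sup>+l. ennreal (?I l) \<partial>Pi\<^sub>M C (\<lambda>_. count_space UNIV))"
    by simp
  also have "\<dots> = ennreal ?v"
    using I point by (subst nn_integral_eq_integral) (auto simp: has_bochner_integral_iff)
  also have "\<dots> = (\<Prod>i<n'. ennreal (1 / (1 - v i))) * ennreal (fun_det n (\<lambda>i j. above r n v i ^ m j - below r v i ^ m j))"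
    using v by (subst prod_ennreal) (auto simp: n'_def less_imp_le intro!: ennreal_mult' prod_nonneg)
  finally show ?thesis
    using True by (simp add: n'_def)
qed

subsection \<open>Lattice columns and weights\<close>

text \<open>For weakly proper \<open>rs\<close> the last column consists of \<open>width rs\<close>
  points, with second coordinates spaced by 2 upwards from \<open>base rs\<close>;
  \<open>point rs\<close> enumerates them.\<close>

definition width :: "step list \<Rightarrow> nat" where
  "width rs = nat (E rs + 1)"

definition base :: "step list \<Rightarrow> int" where
  "base rs = (\<Sum>r\<leftarrow>rs. 1 - 2 * int (offset r))"

definition point :: "step list \<Rightarrow> nat \<Rightarrow> nat \<times> int" where
  "point rs i = (length rs + 1, base rs + 2 * int i)"

definition last_column :: "step list \<Rightarrow> (nat \<times> int) set" where
  "last_column rs = point rs ` {..<width rs}"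

lemma E_snoc [simp]: "E (rs @ [r]) = E rs + step_weight r"
  by (simp add: E_def)

lemma E_Nil [simp]: "E [] = 0"
  by (simp add: E_def)

lemma weakly_proper_snoc: "weakly_proper (rs @ [r]) \<longleftrightarrow> weakly_proper rs \<and> 0 \<le> E (rs @ [r])"
proof -
  have "{1..length (rs @ [r])} = insert (Suc (length rs)) {1..length rs}" by auto
  then show ?thesis
    unfolding weakly_proper_def by auto
qed

lemma weakly_proper_E_nonneg: "weakly_proper rs \<Longrightarrow> 0 \<le> E rs"
  by (cases rs rule: rev_cases) (auto simp: weakly_proper_snoc)

lemma width_pos: "weakly_proper rs \<Longrightarrow> 0 < width rs"
  using weakly_proper_E_nonneg[of rs] by (simp add: width_def)

lemma width_snoc: "weakly_proper (rs @ [r]) \<Longrightarrow> width (rs @ [r]) = next_size r (width rs)"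
  using weakly_proper_E_nonneg[of rs] by (cases r) (auto simp: width_def weakly_proper_snoc nat_add_distrib nat_diff_distrib)

lemma base_snoc [simp]: "base (rs @ [r]) = base rs + (1 - 2 * int (offset r))"
  by (simp add: base_def)

lemma column_append: "n \<le> length rs \<Longrightarrow> column (rs @ rs') n = column rs n"
  by (induction n) (auto simp: nth_append)

text \<open>The upward and downward shifts of the column are the same progression displaced by one
  index, so their union has one point more and their intersection one point less than the
  column.\<close>

lemma next_column_progression:
  assumes "0 < n"
  shows "next_column r ((\<lambda>i. b + 2 * int i) ` {..<n})
       = (\<lambda>i. b + (1 - 2 * int (offset r)) + 2 * int i) ` {..<next_size r n}"
proof -
  have up: "(\<lambda>y. y + 1) ` (\<lambda>i. b + 2 * int i) ` {..<n} = (\<lambda>i. b + 1 + 2 * int i) ` {..<n}"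
    by (auto simp: image_image algebra_simps)
  have down: "(\<lambda>y. y - 1) ` (\<lambda>i. b + 2 * int i) ` {..<n} = (\<lambda>i. b - 1 + 2 * int i) ` {..<n}"
    by (auto simp: image_image algebra_simps)
  show ?thesis
  proof (cases r)
    case Op
    have "(\<lambda>i. b + 1 + 2 * int i) ` {..<n} = (\<lambda>i. b - 1 + 2 * int i) ` Suc ` {..<n}"
      by (auto simp: image_image algebra_simps)
    moreover have "Suc ` {..<n} \<union> {..<n} = {..<Suc n}"
    proof -
      have "x \<in> Suc ` {..<n} \<union> {..<n} \<longleftrightarrow> x \<in> {..<Suc n}" for x
        using assms by (cases x) auto
      then show ?thesis by blast
    qed
    ultimately show ?thesis
      unfolding Op next_column.simps up down by (simp flip: image_Un)
  next
    case Cl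
    have "(\<lambda>i. b + 1 + 2 * int i) ` {..<n} \<inter> (\<lambda>i. b - 1 + 2 * int i) ` {..<n} = (\<lambda>i. b + 1 + 2 * int i) ` {..<n - 1}"
    proof (intro equalityI subsetI)
      fix z assume "z \<in> (\<lambda>i. b + 1 + 2 * int i) ` {..<n} \<inter> (\<lambda>i. b - 1 + 2 * int i) ` {..<n}"
      then obtain i j where "z = b + 1 + 2 * int i" "z = b - 1 + 2 * int j" "j < n"
        by (elim IntE imageE) (use that in blast)
      then show "z \<in> (\<lambda>i. b + 1 + 2 * int i) ` {..<n - 1}"
        by (intro image_eqI[of _ _ i]) auto
    next
      fix z assume "z \<in> (\<lambda>i. b + 1 + 2 * int i) ` {..<n - 1}"
      then obtain i where "z = b + 1 + 2 * int i" "i < n - 1" by auto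
      then show "z \<in> (\<lambda>i. b + 1 + 2 * int i) ` {..<n} \<inter> (\<lambda>i. b - 1 + 2 * int i) ` {..<n}"
        by (intro IntI image_eqI[of _ _ i] image_eqI[of _ _ "Suc i"]) auto
    qed
    then show ?thesis
      unfolding Cl next_column.simps up down by simp
  qed (use up down in simp_all)
qed

lemma column_length: "weakly_proper rs \<Longrightarrow> column rs (length rs) = (\<lambda>i. base rs + 2 * int i) ` {..<width rs}"
proof (induction rs rule: rev_induct)
  case Nil
  then show ?case by (simp add: base_def width_def lessThan_Suc)
next
  case (snoc r rs)
  then have wp: "weakly_proper rs" by (simp add: weakly_proper_snoc)
  have "column (rs @ [r]) (length (rs @ [r])) = next_column r (column rs (length rs))"
    by (simp add: column_append)
  also have "\<dots> = (\<lambda>i. base (rs @ [r]) + 2 * int i) ` {..<width (rs @ [r])}"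
    unfolding snoc.IH[OF wp] next_column_progression[OF width_pos[OF wp]] width_snoc[OF snoc.prems] by simp
  finally show ?case .
qed

lemma mem_last_column: "weakly_proper rs \<Longrightarrow> (length rs + 1, y) \<in> last_column rs \<longleftrightarrow> y \<in> column rs (length rs)"
  by (auto simp: last_column_def point_def column_length)

lemma bij_betw_point: "bij_betw (point rs) {..<width rs} (last_column rs)"
  unfolding last_column_def by (intro inj_on_imp_bij_betw inj_onI) (simp add: point_def)

lemma finite_last_column [simp]: "finite (last_column rs)"
  by (simp add: last_column_def)

lemma point_mem [simp]: "i < width rs \<Longrightarrow> point rs i \<in> last_column rs"
  by (simp add: last_column_def)

lemma last_column_fst: "p \<in> last_column rs \<Longrightarrow> fst p = length rs + 1"
  by (auto simp: last_column_def point_def)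

lemma L_Nil: "L [] = last_column []"
  by (auto simp: L_def last_column_def point_def base_def width_def)

lemma last_column_subset: "weakly_proper rs \<Longrightarrow> last_column rs \<subseteq> L rs"
  by (auto simp: last_column_def L_def point_def column_length)

lemma L_fst: "p \<in> L rs \<Longrightarrow> 1 \<le> fst p \<and> fst p \<le> length rs + 1"
  by (auto simp: L_def)

lemma mem_L_snoc_old: "x \<le> length rs + 1 \<Longrightarrow> (x, y) \<in> L (rs @ [r]) \<longleftrightarrow> (x, y) \<in> L rs"
  by (auto simp: L_def column_append)

lemma mem_L_last: "weakly_proper rs \<Longrightarrow> (length rs + 1, y) \<in> L rs \<longleftrightarrow> (length rs + 1, y) \<in> last_column rs"
  using mem_last_column[of rs y] by (simp add: L_def)

lemma L_snoc:
  assumes "weakly_proper (rs @ [r])"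
  shows "L (rs @ [r]) = L rs \<union> last_column (rs @ [r])" and "L rs \<inter> last_column (rs @ [r]) = {}"
proof -
  show "L rs \<inter> last_column (rs @ [r]) = {}"
    using L_fst last_column_fst by fastforce
  have "(x, y) \<in> L (rs @ [r]) \<longleftrightarrow> (x, y) \<in> L rs \<or> (x, y) \<in> last_column (rs @ [r])" for x y
  proof (cases "x \<le> length rs + 1")
    case True
    then show ?thesis using mem_L_snoc_old last_column_fst[of "(x, y)" "rs @ [r]"] by auto
  next
    case False
    then have "(x, y) \<in> L (rs @ [r]) \<longleftrightarrow> x = length (rs @ [r]) + 1 \<and> (x, y) \<in> L (rs @ [r])"
      using L_fst[of "(x, y)" "rs @ [r]"] by auto
    also have "\<dots> \<longleftrightarrow> (x, y) \<in> last_column (rs @ [r])"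
      using mem_L_last[OF assms, of y] last_column_fst[of "(x, y)" "rs @ [r]"] by auto
    finally show ?thesis using L_fst[of "(x, y)" rs] False by auto
  qed
  then show "L (rs @ [r]) = L rs \<union> last_column (rs @ [r])" by auto
qed

lemma finite_L: "weakly_proper rs \<Longrightarrow> finite (L rs)"
  by (induction rs rule: rev_induct) (auto simp: L_Nil L_snoc weakly_proper_snoc)

text \<open>One predicate serves both sides: the relations \<open><\<close> and \<open>>\<close>
  describe the poset, \<open><\<close> and \<open>\<ge>\<close> the index set of the series.\<close>

definition compatible :: "('a \<Rightarrow> 'a \<Rightarrow> bool) \<Rightarrow> ('a \<Rightarrow> 'a \<Rightarrow> bool) \<Rightarrow> step list \<Rightarrow> (nat \<times> int \<Rightarrow> 'a) \<Rightarrow> bool" where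
  "compatible R1 R2 rs f \<longleftrightarrow>
     (\<forall>x y. (x, y) \<in> L rs \<and> (x + 1, y + 1) \<in> L rs \<longrightarrow> R1 (f (x, y)) (f (x + 1, y + 1))) \<and>
     (\<forall>x y. (x, y) \<in> L rs \<and> (x + 1, y - 1) \<in> L rs \<longrightarrow> R2 (f (x, y)) (f (x + 1, y - 1)))"

text \<open>All conditions concern adjacent columns, so a further column adds exactly the conditions
  that link it to the former last one.\<close>

lemma compatible_snoc:
  assumes wp: "weakly_proper (rs @ [r])"
  shows "compatible R1 R2 (rs @ [r]) f \<longleftrightarrow> compatible R1 R2 rs f \<and>
    linked R1 R2 r (width rs) (\<lambda>i. f (point rs i)) (\<lambda>i. f (point (rs @ [r]) i))"
proof -
  let ?rs = "rs @ [r]" and ?N = "length rs + 1"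
  have wp': "weakly_proper rs" using wp by (simp add: weakly_proper_snoc)
  \<comment> \<open>With \<open>c = 1\<close> and \<open>c = -1\<close> this treats both kinds of
    conditions at once: pairs of old points are separated from pairs whose right member lies in the
    new column.\<close>
  have split: "(\<forall>x y. (x, y) \<in> L ?rs \<and> (x + 1, y + c) \<in> L ?rs \<longrightarrow> Q x y) \<longleftrightarrow>
      (\<forall>x y. (x, y) \<in> L rs \<and> (x + 1, y + c) \<in> L rs \<longrightarrow> Q x y) \<and>
      (\<forall>i k. i < width rs \<and> k < width ?rs \<and> point ?rs k = (?N + 1, base rs + 2 * int i + c) \<longrightarrow> Q ?N (base rs + 2 * int i))"
    for Q and c :: int
  proof (intro iffI conjI allI impI)
    fix x y assume A: "\<forall>x y. (x, y) \<in> L ?rs \<and> (x + 1, y + c) \<in> L ?rs \<longrightarrow> Q x y"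
      and "(x, y) \<in> L rs \<and> (x + 1, y + c) \<in> L rs"
    then show "Q x y" using L_snoc(1)[OF wp] by blast
  next
    fix i k assume A: "\<forall>x y. (x, y) \<in> L ?rs \<and> (x + 1, y + c) \<in> L ?rs \<longrightarrow> Q x y"
      and i: "i < width rs \<and> k < width ?rs \<and> point ?rs k = (?N + 1, base rs + 2 * int i + c)"
    have "point rs i \<in> L ?rs" "point ?rs k \<in> L ?rs"
      using i point_mem[of i rs] point_mem[of k ?rs] L_snoc(1)[OF wp] last_column_subset[OF wp'] by blast+
    moreover have "point rs i = (?N, base rs + 2 * int i)"
      by (simp add: point_def)
    ultimately show "Q ?N (base rs + 2 * int i)"
      using A i by metis
  next
    fix x y assume A: "(\<forall>x y. (x, y) \<in> L rs \<and> (x + 1, y + c) \<in> L rs \<longrightarrow> Q x y) \<and>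
      (\<forall>i k. i < width rs \<and> k < width ?rs \<and> point ?rs k = (?N + 1, base rs + 2 * int i + c) \<longrightarrow> Q ?N (base rs + 2 * int i))"
      and xy: "(x, y) \<in> L ?rs \<and> (x + 1, y + c) \<in> L ?rs"
    consider "x + 1 \<le> ?N" | "x = ?N"
      using xy L_fst[of "(x + 1, y + c)" ?rs] by auto linarith
    then show "Q x y"
    proof cases
      case 1
      then have "(x, y) \<in> L rs \<and> (x + 1, y + c) \<in> L rs"
        using xy mem_L_snoc_old by simp
      with A show ?thesis by blast
    next
      case 2
      then have "(x, y) \<in> last_column rs"
        using xy mem_L_snoc_old[of x rs y r] mem_L_last[OF wp'] by simp
      then obtain i where i: "i < width rs" "(x, y) = point rs i"
        by (auto simp: last_column_def)
      have "(x + 1, y + c) \<in> last_column ?rs"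
        using xy 2 mem_L_last[OF wp, of "y + c"] by simp
      then obtain k where k: "k < width ?rs" "(x + 1, y + c) = point ?rs k"
        by (auto simp: last_column_def)
      have "Q ?N (base rs + 2 * int i)"
        using A[THEN conjunct2, rule_format, of i k] i k by (simp add: point_def)
      with i(2) show ?thesis by (simp add: point_def)
    qed
  qed
  have w: "width ?rs = next_size r (width rs)"
    by (rule width_snoc[OF wp])
  have up: "point ?rs k = (?N + 1, base rs + 2 * int i + 1) \<longleftrightarrow> k = i + offset r" for i k
    by (auto simp: point_def)
  have down: "point ?rs k = (?N + 1, base rs + 2 * int i + (- 1)) \<longleftrightarrow> 0 < i + offset r \<and> k = i + offset r - 1" for i k
    by (auto simp: point_def)
  have bound: "i + offset r - 1 < width ?rs" if "i < width rs" "0 < i + offset r" for i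
    using that unfolding w by (cases r) auto
  have pt: "(?N, base rs + 2 * int i) = point rs i" for i
    by (simp add: point_def)
  have pt1: "(?N + 1, base rs + 2 * int i + 1) = point ?rs (i + offset r)" for i
    by (simp add: point_def)
  have pt2: "(?N + 1, base rs + 2 * int i - 1) = point ?rs (i + offset r - 1)" if "0 < i + offset r" for i
  proof -
    have "int (i + offset r - 1) = int i + int (offset r) - 1"
      using that by linarith
    then show ?thesis
      by (simp only: point_def base_snoc) simp
  qed
  have 1: "(\<forall>x y. (x, y) \<in> L ?rs \<and> (x + 1, y + 1) \<in> L ?rs \<longrightarrow> R1 (f (x, y)) (f (x + 1, y + 1))) \<longleftrightarrow>
      (\<forall>x y. (x, y) \<in> L rs \<and> (x + 1, y + 1) \<in> L rs \<longrightarrow> R1 (f (x, y)) (f (x + 1, y + 1))) \<and>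
      (\<forall>i<width rs. i + offset r < width ?rs \<longrightarrow> R1 (f (point rs i)) (f (point ?rs (i + offset r))))"
    unfolding split[of 1 "\<lambda>x y. R1 (f (x, y)) (f (x + 1, y + 1))"] up
    unfolding pt pt1 by (intro arg_cong2[where f = "(\<and>)"] refl) auto
  have 2: "(\<forall>x y. (x, y) \<in> L ?rs \<and> (x + 1, y - 1) \<in> L ?rs \<longrightarrow> R2 (f (x, y)) (f (x + 1, y - 1))) \<longleftrightarrow>
      (\<forall>x y. (x, y) \<in> L rs \<and> (x + 1, y - 1) \<in> L rs \<longrightarrow> R2 (f (x, y)) (f (x + 1, y - 1))) \<and>
      (\<forall>i<width rs. 0 < i + offset r \<longrightarrow> R2 (f (point rs i)) (f (point ?rs (i + offset r - 1))))"
  proof -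
    have "(\<forall>i k. i < width rs \<and> k < width ?rs \<and> 0 < i + offset r \<and> k = i + offset r - 1 \<longrightarrow>
          R2 (f (?N, base rs + 2 * int i)) (f (?N + 1, base rs + 2 * int i - 1))) \<longleftrightarrow>
        (\<forall>i<width rs. 0 < i + offset r \<longrightarrow> R2 (f (point rs i)) (f (point ?rs (i + offset r - 1))))"
      using bound pt2 unfolding pt by metis
    then show ?thesis
      using split[of "-1" "\<lambda>x y. R2 (f (x, y)) (f (x + 1, y - 1))"] unfolding down by simp
  qed
  show ?thesis
    unfolding compatible_def linked_def 1 2 w[symmetric] by (simp only: all_conj_distrib imp_conjR conj_ac)
qed

section \<open>Weights and the splitting off of the last column\<close>

lemma borel_measurable_of_bool:
  "Measurable.pred M Q \<Longrightarrow> (\<lambda>x. of_bool (Q x) :: ennreal) \<in> borel_measurable M"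
  unfolding of_bool_def by measurable

definition weight ::
  "('a \<Rightarrow> 'a \<Rightarrow> bool) \<Rightarrow> ('a \<Rightarrow> 'a \<Rightarrow> bool) \<Rightarrow> (nat \<Rightarrow> 'a \<Rightarrow> ennreal) \<Rightarrow> step list \<Rightarrow> (nat \<times> int \<Rightarrow> 'a) \<Rightarrow> ennreal" where
  "weight R1 R2 w rs f = of_bool (compatible R1 R2 rs f) * (\<Prod>p\<in>L rs. w (fst p) (f p))"

lemma compatible_cong: "(\<And>p. p \<in> L rs \<Longrightarrow> f p = g p) \<Longrightarrow> compatible R1 R2 rs f = compatible R1 R2 rs g"
  unfolding compatible_def by simp

lemma weight_cong:
  assumes "\<And>p. p \<in> L rs \<Longrightarrow> f p = g p"
    and "\<And>x. 1 \<le> x \<Longrightarrow> x \<le> length rs + 1 \<Longrightarrow> w x = w' x"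
  shows "weight R1 R2 w rs f = weight R1 R2 w' rs g"
proof -
  have "(\<Prod>p\<in>L rs. w (fst p) (f p)) = (\<Prod>p\<in>L rs. w' (fst p) (g p))"
    using assms L_fst by (intro prod.cong) auto
  then show ?thesis
    unfolding weight_def using compatible_cong[of rs f g R1 R2] assms(1) by simp
qed

lemma weight_snoc:
  assumes wp: "weakly_proper (rs @ [r])"
  shows "weight R1 R2 w (rs @ [r]) f = weight R1 R2 w rs f *
    ((\<Prod>p\<in>last_column (rs @ [r]). w (length rs + 2) (f p)) *
     of_bool (linked R1 R2 r (width rs) (\<lambda>i. f (point rs i)) (\<lambda>i. f (point (rs @ [r]) i))))"
proof -
  have wp': "weakly_proper rs" using wp by (simp add: weakly_proper_snoc)
  have "(\<Prod>p\<in>last_column (rs @ [r]). w (fst p) (f p)) = (\<Prod>p\<in>last_column (rs @ [r]). w (length rs + 2) (f p))"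
    using last_column_fst[of _ "rs @ [r]"] by (intro prod.cong) auto
  then have "(\<Prod>p\<in>L (rs @ [r]). w (fst p) (f p))
      = (\<Prod>p\<in>L rs. w (fst p) (f p)) * (\<Prod>p\<in>last_column (rs @ [r]). w (length rs + 2) (f p))"
    using L_snoc[OF wp] finite_L[OF wp'] by (simp add: prod.union_disjoint)
  then show ?thesis
    unfolding weight_def compatible_snoc[OF wp] by (simp add: of_bool_conj mult_ac)
qed

lemma pred_relation:
  assumes "Measurable.pred (N \<Otimes>\<^sub>M N) (\<lambda>(a, b). R a b)" "f \<in> M \<rightarrow>\<^sub>M N" "g \<in> M \<rightarrow>\<^sub>M N"
  shows "Measurable.pred M (\<lambda>x. R (f x) (g x))"
  using measurable_compose[OF measurable_Pair[OF assms(2,3)] assms(1)] by simp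

lemma pred_const_imp: "(A \<Longrightarrow> Measurable.pred M B) \<Longrightarrow> Measurable.pred M (\<lambda>x. A \<longrightarrow> B x)"
  by (cases A) simp_all

lemma pred_linked:
  assumes R: "Measurable.pred (N \<Otimes>\<^sub>M N) (\<lambda>(a, b). R1 a b)" "Measurable.pred (N \<Otimes>\<^sub>M N) (\<lambda>(a, b). R2 a b)"
    and u: "\<And>i. i < n \<Longrightarrow> (\<lambda>x. u x i) \<in> M \<rightarrow>\<^sub>M N"
    and v: "\<And>i. i < next_size r n \<Longrightarrow> (\<lambda>x. v x i) \<in> M \<rightarrow>\<^sub>M N"
  shows "Measurable.pred M (\<lambda>x. linked R1 R2 r n (u x) (v x))"
proof -
  have "Measurable.pred M (\<lambda>x. i < n \<longrightarrow> (i + offset r < next_size r n \<longrightarrow> R1 (u x i) (v x (i + offset r))) \<and>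
     (0 < i + offset r \<longrightarrow> R2 (u x i) (v x (i + offset r - 1))))" for i
  proof (cases "i < n")
    case True
    have "i + offset r - 1 < next_size r n" if "0 < i + offset r"
      using True that by (cases r) auto
    then show ?thesis
      by (intro pred_const_imp pred_intros_logic(3) pred_relation[OF R(1)] pred_relation[OF R(2)] u v)
  next
    case False
    then show ?thesis by simp
  qed
  then show ?thesis
    unfolding linked_def by (rule pred_intros_countable(1))
qed

lemma pred_compatible:
  assumes R: "Measurable.pred (N \<Otimes>\<^sub>M N) (\<lambda>(a, b). R1 a b)" "Measurable.pred (N \<Otimes>\<^sub>M N) (\<lambda>(a, b). R2 a b)"
  shows "Measurable.pred (Pi\<^sub>M (L rs) (\<lambda>_. N)) (compatible R1 R2 rs)"
proof -
  have comp: "p \<in> L rs \<Longrightarrow> (\<lambda>f. f p) \<in> Pi\<^sub>M (L rs) (\<lambda>_. N) \<rightarrow>\<^sub>M N" for p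
    by (rule measurable_component_singleton)
  have *: "Measurable.pred (Pi\<^sub>M (L rs) (\<lambda>_. N)) (\<lambda>f. p \<in> L rs \<and> q \<in> L rs \<longrightarrow> R (f p) (f q))"
    if "Measurable.pred (N \<Otimes>\<^sub>M N) (\<lambda>(a, b). R a b)" for p q R
    by (intro pred_const_imp pred_relation[OF that] comp) auto
  show ?thesis
    unfolding compatible_def[abs_def] by (intro pred_intros_logic(3) pred_intros_countable(1) *[OF R(1)] *[OF R(2)])
qed

lemma weight_measurable:
  assumes "Measurable.pred (N \<Otimes>\<^sub>M N) (\<lambda>(a, b). R1 a b)" "Measurable.pred (N \<Otimes>\<^sub>M N) (\<lambda>(a, b). R2 a b)"
    and "\<And>x. w x \<in> borel_measurable N"
  shows "weight R1 R2 w rs \<in> borel_measurable (Pi\<^sub>M (L rs) (\<lambda>_. N))"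
  unfolding weight_def[abs_def]
  by (intro borel_measurable_times_ennreal borel_measurable_of_bool pred_compatible assms borel_measurable_prod_ennreal
      measurable_compose[OF measurable_component_singleton])

text \<open>Tonelli on the product of the old points and the new column. The added factor sees the
  old points only through their last column. The general measure covers both the integral and, with
  the counting measure, the series.\<close>

lemma weight_snoc_integral:
  assumes N: "sigma_finite_measure N" and wp: "weakly_proper (rs @ [r])"
    and R: "Measurable.pred (N \<Otimes>\<^sub>M N) (\<lambda>(a, b). R1 a b)" "Measurable.pred (N \<Otimes>\<^sub>M N) (\<lambda>(a, b). R2 a b)"
    and w: "\<And>x. w x \<in> borel_measurable N"
    and g: "g \<in> borel_measurable (Pi\<^sub>M (last_column (rs @ [r])) (\<lambda>_. N))"
  shows "(\<integral>\<^sup>+f. weight R1 R2 w (rs @ [r]) f * g (restrict f (last_column (rs @ [r]))) \<partial>Pi\<^sub>M (L (rs @ [r])) (\<lambda>_. N))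
    = (\<integral>\<^sup>+u. weight R1 R2 w rs u * (\<integral>\<^sup>+v. (\<Prod>p\<in>last_column (rs @ [r]). w (length rs + 2) (v p)) *
        (of_bool (linked R1 R2 r (width rs) (\<lambda>i. u (point rs i)) (\<lambda>i. v (point (rs @ [r]) i))) * g v)
        \<partial>Pi\<^sub>M (last_column (rs @ [r])) (\<lambda>_. N)) \<partial>Pi\<^sub>M (L rs) (\<lambda>_. N))"
proof -
  interpret sigma_finite_measure N by fact
  interpret product_sigma_finite "\<lambda>_. N" ..
  let ?rs = "rs @ [r]"
  let ?C = "last_column ?rs"
  have wp': "weakly_proper rs" using wp by (simp add: weakly_proper_snoc)
  have Lrs: "L ?rs = L rs \<union> ?C" "L rs \<inter> ?C = {}"
    using L_snoc[OF wp] by auto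
  have fin: "finite (L rs)" by (rule finite_L[OF wp'])
  have F: "(\<lambda>f. weight R1 R2 w ?rs f * g (restrict f ?C)) \<in> borel_measurable (Pi\<^sub>M (L rs \<union> ?C) (\<lambda>_. N))"
    unfolding Lrs(1)[symmetric]
    by (intro borel_measurable_times_ennreal weight_measurable R w measurable_compose[OF measurable_restrict_subset g])
      (auto simp: Lrs)
  have "(\<integral>\<^sup>+f. weight R1 R2 w ?rs f * g (restrict f ?C) \<partial>Pi\<^sub>M (L ?rs) (\<lambda>_. N))
      = (\<integral>\<^sup>+u. (\<integral>\<^sup>+v. weight R1 R2 w ?rs (merge (L rs) ?C (u, v)) * g (restrict (merge (L rs) ?C (u, v)) ?C)
           \<partial>Pi\<^sub>M ?C (\<lambda>_. N)) \<partial>Pi\<^sub>M (L rs) (\<lambda>_. N))"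
    unfolding Lrs(1) by (rule product_nn_integral_fold[OF Lrs(2) fin finite_last_column F])
  also have "\<dots> = (\<integral>\<^sup>+u. weight R1 R2 w rs u * (\<integral>\<^sup>+v. (\<Prod>p\<in>?C. w (length rs + 2) (v p)) *
        (of_bool (linked R1 R2 r (width rs) (\<lambda>i. u (point rs i)) (\<lambda>i. v (point ?rs i))) * g v)
        \<partial>Pi\<^sub>M ?C (\<lambda>_. N)) \<partial>Pi\<^sub>M (L rs) (\<lambda>_. N))"
  proof (rule nn_integral_cong)
    fix u assume u: "u \<in> space (Pi\<^sub>M (L rs) (\<lambda>_. N))"
    let ?Q = "\<lambda>v. linked R1 R2 r (width rs) (\<lambda>i. u (point rs i)) (\<lambda>i. v (point ?rs i))"
    let ?G = "\<lambda>v. (\<Prod>p\<in>?C. w (length rs + 2) (v p)) * (of_bool (?Q v) * g v)"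
    have pt: "i < width rs \<Longrightarrow> point rs i \<in> L rs" for i
      using point_mem last_column_subset[OF wp'] by blast
    have G: "?G \<in> borel_measurable (Pi\<^sub>M ?C (\<lambda>_. N))"
    proof -
      have "Measurable.pred (Pi\<^sub>M ?C (\<lambda>_. N)) ?Q"
        using u pt by (intro pred_linked[OF R])
          (auto simp: width_snoc[OF wp, symmetric] space_PiM PiE_iff intro!: measurable_component_singleton)
      then show ?thesis
        by (intro borel_measurable_times_ennreal borel_measurable_of_bool g borel_measurable_prod_ennreal
            measurable_compose[OF measurable_component_singleton[where M = "\<lambda>_. N"] w])
    qed
    have "(\<integral>\<^sup>+v. weight R1 R2 w ?rs (merge (L rs) ?C (u, v)) * g (restrict (merge (L rs) ?C (u, v)) ?C) \<partial>Pi\<^sub>M ?C (\<lambda>_. N))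
        = (\<integral>\<^sup>+v. weight R1 R2 w rs u * ?G v \<partial>Pi\<^sub>M ?C (\<lambda>_. N))"
    proof (rule nn_integral_cong)
      fix v assume v: "v \<in> space (Pi\<^sub>M ?C (\<lambda>_. N))"
      let ?m = "merge (L rs) ?C (u, v)"
      have mu: "?m p = u p" if "p \<in> L rs" for p
        using that by (simp add: merge_def)
      have mv: "?m p = v p" if "p \<in> ?C" for p
        using that Lrs(2) by (auto simp: merge_def)
      have r: "restrict ?m ?C = v"
        using v mv by (auto simp: space_PiM PiE_iff extensional_def fun_eq_iff)
      have a: "weight R1 R2 w rs ?m = weight R1 R2 w rs u"
        by (rule weight_cong) (use mu in auto)
      have b: "(\<Prod>p\<in>?C. w (length rs + 2) (?m p)) = (\<Prod>p\<in>?C. w (length rs + 2) (v p))"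
        by (rule prod.cong) (use mv in auto)
      have c: "linked R1 R2 r (width rs) (\<lambda>i. ?m (point rs i)) (\<lambda>i. ?m (point ?rs i)) = ?Q v"
      proof -
        have "?m (point rs i) = u (point rs i)" if "i < width rs" for i
          using mu[OF pt[OF that]] .
        moreover have "?m (point ?rs i) = v (point ?rs i)" if "i < next_size r (width rs)" for i
          using mv[OF point_mem] that by (simp add: width_snoc[OF wp])
        ultimately show ?thesis
          by (rule linked_cong)
      qed
      show "weight R1 R2 w ?rs ?m * g (restrict ?m ?C) = weight R1 R2 w rs u * ?G v"
        unfolding weight_snoc[OF wp] r a b c by (simp only: mult.assoc)
    qed
    also have "\<dots> = weight R1 R2 w rs u * (\<integral>\<^sup>+v. ?G v \<partial>Pi\<^sub>M ?C (\<lambda>_. N))"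
      by (rule nn_integral_cmult[OF G])
    finally show "(\<integral>\<^sup>+v. weight R1 R2 w ?rs (merge (L rs) ?C (u, v)) * g (restrict (merge (L rs) ?C (u, v)) ?C) \<partial>Pi\<^sub>M ?C (\<lambda>_. N))
        = weight R1 R2 w rs u * (\<integral>\<^sup>+v. ?G v \<partial>Pi\<^sub>M ?C (\<lambda>_. N))" .
  qed
  finally show ?thesis .
qed

lemma kernel_measurable:
  assumes t: "\<And>i. i < n \<Longrightarrow> (\<lambda>x. t x i) \<in> borel_measurable M"
  shows "(\<lambda>x. kernel n (t x) m) \<in> borel_measurable M"
proof -
  have "Measurable.pred M (\<lambda>x. i < n \<longrightarrow> 0 < t x i \<and> t x i < 1)" for i
    using t[of i] by (cases "i < n") (simp_all add: pred_intros_logic(3) borel_measurable_pred_less)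
  moreover have "Measurable.pred M (\<lambda>x. Suc i < n \<longrightarrow> t x i < t x (Suc i))" for i
    using t[of i] t[of "Suc i"] by (cases "Suc i < n") (simp_all add: borel_measurable_pred_less)
  ultimately have P: "Measurable.pred M (\<lambda>x. (\<forall>i<n. 0 < t x i \<and> t x i < 1) \<and> increasing n (t x))"
    unfolding increasing_def by (intro pred_intros_logic(3) pred_intros_countable(1))
  have D: "(\<lambda>x. fun_det n (\<lambda>i j. real (m j) * t x i ^ (m j - 1))) \<in> borel_measurable M"
    unfolding fun_det_leibniz
    by (intro borel_measurable_sum borel_measurable_times borel_measurable_const borel_measurable_prod borel_measurable_power t)
      auto
  show ?thesis
    unfolding kernel_def by (intro measurable_If measurable_compose[OF D measurable_ennreal] borel_measurable_const predE[OF P])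
qed

subsection \<open>Induction along the word\<close>

lemma countable_PiE_UNIV: "finite J \<Longrightarrow> countable (J \<rightarrow>\<^sub>E (UNIV :: nat set))"
  by (intro countable_PiE) auto

lemma PiM_count_space: "finite J \<Longrightarrow> Pi\<^sub>M J (\<lambda>_. count_space (UNIV :: nat set)) = count_space (J \<rightarrow>\<^sub>E UNIV)"
  by (rule count_space_PiM_finite) auto

lemma measurable_PiM_count_space:
  "finite J \<Longrightarrow> f \<in> borel_measurable (Pi\<^sub>M J (\<lambda>_. count_space (UNIV :: nat set)))"
  by (simp add: PiM_count_space)

text \<open>The families \<open>l\<close> form a countable set, so the interchange asks for
  measurability of each \<open>f l\<close> alone instead of joint measurability.\<close>

lemma nn_integral_swap_count:
  assumes "finite J" and "\<And>l. f l \<in> borel_measurable M"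
  shows "(\<integral>\<^sup>+v. (\<integral>\<^sup>+l. f l v \<partial>Pi\<^sub>M J (\<lambda>_. count_space (UNIV :: nat set))) \<partial>M)
    = (\<integral>\<^sup>+l. (\<integral>\<^sup>+v. f l v \<partial>M) \<partial>Pi\<^sub>M J (\<lambda>_. count_space (UNIV :: nat set)))"
  unfolding PiM_count_space[OF assms(1)]
  by (rule nn_integral_count_space_nn_integral) (use assms countable_PiE_UNIV in auto)

lemma pred_count_space: "Measurable.pred (count_space (UNIV :: nat set) \<Otimes>\<^sub>M count_space (UNIV :: nat set)) Q"
  by (subst pair_measure_countable) auto

lemma pred_less_lborel:
  "Measurable.pred (lborel \<Otimes>\<^sub>M lborel) (\<lambda>(a, b). a < (b :: real))"
  "Measurable.pred (lborel \<Otimes>\<^sub>M lborel) (\<lambda>(a, b). a > (b :: real))"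
  unfolding case_prod_beta
  by (intro borel_measurable_pred_less measurable_compose[OF measurable_fst] measurable_compose[OF measurable_snd] measurable_lborel1 measurable_ident_sets; simp)+

text \<open>The endpoints are excluded; they form a null set.\<close>

definition form_weight :: "mark \<Rightarrow> real \<Rightarrow> ennreal" where
  "form_weight d x = (if 0 < x \<and> x < 1 then ennreal (form_density d x) else 0)"

lemma form_weight_measurable: "form_weight d \<in> borel_measurable lborel"
proof -
  have "form_density d = (case d of White \<Rightarrow> \<lambda>x. 1 / x | Black \<Rightarrow> \<lambda>x. 1 / (1 - x))"
    by (rule ext) (cases d; simp)
  then have [measurable]: "form_density d \<in> borel_measurable borel"
    by (cases d) simp_all
  show ?thesis
    unfolding form_weight_def[abs_def] by measurable
qed

abbreviation integral_weight :: "mark list \<Rightarrow> step list \<Rightarrow> (nat \<times> int \<Rightarrow> real) \<Rightarrow> ennreal" where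
  "integral_weight ds \<equiv> weight (<) (>) (\<lambda>x. form_weight (ds ! (x - 1)))"

abbreviation series_weight :: "nat list \<Rightarrow> step list \<Rightarrow> (nat \<times> int \<Rightarrow> nat) \<Rightarrow> ennreal" where
  "series_weight ks \<equiv> weight (<) (\<ge>) (\<lambda>x. inverse_power (ks ! (x - 1)))"

text \<open>The law of the last column of the integral, in weak form: the test function \<open>g\<close> stands
  for all columns that are still to come.\<close>

definition represents :: "nat list \<Rightarrow> step list \<Rightarrow> mark list \<Rightarrow> step list \<Rightarrow> bool" where
  "represents ks rs ds ws \<longleftrightarrow>
     weakly_proper rs \<and> weakly_proper ws \<and> E ws = E rs \<and>
     length ks = length rs + 1 \<and> length ds = length ws + 1 \<and>
     (\<forall>g \<in> borel_measurable (Pi\<^sub>M (last_column ws) (\<lambda>_. lborel)).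
       (\<integral>\<^sup>+u. integral_weight ds ws u * g (restrict u (last_column ws)) \<partial>Pi\<^sub>M (L ws) (\<lambda>_. lborel))
     = (\<integral>\<^sup>+m. series_weight ks rs m *
         (\<integral>\<^sup>+t. kernel (width rs) (\<lambda>i. t (point ws i)) (\<lambda>i. m (point rs i)) * g t
           \<partial>Pi\<^sub>M (last_column ws) (\<lambda>_. lborel)) \<partial>Pi\<^sub>M (L rs) (\<lambda>_. count_space UNIV)))"

text \<open>Provides the positive increasing exponents on which the transition lemmas depend;
  families of weight 0 are then treated separately. Monotonicity in the last column comes from its
  links to the column before it.\<close>

lemma series_weight_nonzero:
  assumes wp: "weakly_proper rs" and nz: "series_weight ks rs m \<noteq> 0"
  shows "p \<in> L rs \<Longrightarrow> 0 < m p" "j < width rs \<Longrightarrow> 0 < m (point rs j)" "increasing (width rs) (\<lambda>i. m (point rs i))"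
proof -
  show *: "0 < m p" if "p \<in> L rs" for p
  proof (rule ccontr)
    assume "\<not> 0 < m p"
    then have "(\<Prod>p\<in>L rs. inverse_power (ks ! (fst p - 1)) (m p)) = 0"
      using that finite_L[OF wp] by (intro prod_zero bexI[of _ p]) (auto simp: inverse_power_def)
    with nz show False by (simp add: weight_def)
  qed
  show "0 < m (point rs j)" if "j < width rs"
    using * last_column_subset[OF wp] point_mem[OF that] by blast
  have comp: "compatible (<) (\<ge>) rs m"
    using nz by (auto simp: weight_def)
  show "increasing (width rs) (\<lambda>i. m (point rs i))"
  proof (cases rs rule: rev_cases)
    case Nil
    then show ?thesis by (simp add: width_def increasing_def)
  next
    case (snoc rs' r)
    with wp comp have "linked (<) (\<ge>) r (width rs') (\<lambda>i. m (point rs' i)) (\<lambda>i. m (point rs i))"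
      using compatible_snoc[of rs' r "(<)" "(\<ge>)" m] by simp
    then show ?thesis
      using linked_increasing_right[of "(<)" "(\<ge>)"] width_snoc[of rs' r] wp snoc by force
  qed
qed

section \<open>Black and white transitions\<close>

lemma kernel_cong:
  assumes "\<And>i. i < n \<Longrightarrow> t i = t' i" "\<And>i. i < n \<Longrightarrow> m i = m' i"
  shows "kernel n t m = kernel n t' m'"
proof -
  have "increasing n t = increasing n t'"
    using assms(1) unfolding increasing_def by (metis Suc_lessD)
  moreover have "fun_det n (\<lambda>i j. real (m j) * t i ^ (m j - 1)) = fun_det n (\<lambda>i j. real (m' j) * t' i ^ (m' j - 1))"
    using assms by (intro fun_det_cong) simp
  moreover have "(\<forall>i<n. 0 < t i \<and> t i < 1) = (\<forall>i<n. 0 < t' i \<and> t' i < 1)"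
    using assms(1) by simp
  ultimately show ?thesis
    unfolding kernel_def by (simp only:)
qed

text \<open>Both sides are the product of the \<open>1 / (1 - v i)\<close> times the same
  determinant of differences: once as an integral over the preceding column of the poset, once as a
  sum over the next column of the series.\<close>

lemma kernel_transition_black:
  assumes e: "bij_betw e {..<n} C" and e': "bij_betw e' {..<next_size r n} C'"
    and m: "\<And>j. j < n \<Longrightarrow> 0 < m j" "increasing n m" and n: "r = Cl \<Longrightarrow> 0 < n"
  shows "(\<Prod>i<next_size r n. form_weight Black (v i)) *
      (\<integral>\<^sup>+t. kernel n (\<lambda>i. t (e i)) m * of_bool (linked (<) (>) r n (\<lambda>i. t (e i)) v) \<partial>Pi\<^sub>M C (\<lambda>_. lborel))
    = (\<integral>\<^sup>+l. (\<Prod>c\<in>C'. inverse_power 1 (l c)) *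
        (of_bool (linked (<) (\<ge>) r n m (\<lambda>j. l (e' j))) * kernel (next_size r n) v (\<lambda>j. l (e' j)))
        \<partial>Pi\<^sub>M C' (\<lambda>_. count_space UNIV))"
proof (cases "\<forall>i<next_size r n. 0 < v i \<and> v i < 1")
  case True
  then have "(\<Prod>i<next_size r n. form_weight Black (v i)) = (\<Prod>i<next_size r n. ennreal (1 / (1 - v i)))"
    by (intro prod.cong) (auto simp: form_weight_def)
  then show ?thesis
    using kernel_integral[OF e True m] kernel_sum[OF e' True m n] by simp
next
  case False
  then have "(\<Prod>i<next_size r n. form_weight Black (v i)) = 0"
    by (intro prod_zero) (auto simp: form_weight_def)
  moreover have "kernel (next_size r n) v l = 0" for l
    using False by (auto simp: kernel_def)
  ultimately show ?thesis by simp
qed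

text \<open>For \<open>Up\<close> the intervals run from \<open>v (i - 1)\<close> to
  \<open>v i\<close>, starting at 0, so row operations collapse the differences to det(v_i^m_j).
  Division by the \<open>v i\<close> lowers all exponents by one again, and what is left is
  \<open>kernel\<close> without its factors \<open>m j\<close>.\<close>

lemma kernel_transition_white:
  assumes e: "bij_betw e {..<n} C" and m: "\<And>j. j < n \<Longrightarrow> 0 < m j" "increasing n m"
  shows "(\<Prod>i<n. form_weight White (v i)) *
      (\<integral>\<^sup>+t. kernel n (\<lambda>i. t (e i)) m * of_bool (linked (<) (>) Up n (\<lambda>i. t (e i)) v) \<partial>Pi\<^sub>M C (\<lambda>_. lborel))
    = (\<Prod>j<n. inverse_power 1 (m j)) * kernel n v m"
proof (cases "(\<forall>i<n. 0 < v i \<and> v i < 1) \<and> increasing n v")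
  case True
  then have v: "\<forall>i<n. 0 < v i \<and> v i < 1" by simp
  let ?V = "fun_det n (\<lambda>i j. v i ^ (m j - 1))"
  have "fun_det n (\<lambda>i j. above Up n v i ^ m j - below Up v i ^ m j)
      = fun_det n (\<lambda>i j. v i ^ m j - (if i = 0 then 0 else v (i - 1) ^ m j))"
    using m(1) by (intro fun_det_cong) (simp add: above_def below_def)
  also have "\<dots> = fun_det n (\<lambda>i j. v i ^ m j)"
    by (rule fun_det_row_differences[of n "\<lambda>i j. v i ^ m j"])
  also have "\<dots> = fun_det n (\<lambda>i j. v i * v i ^ (m j - 1))"
  proof (rule fun_det_cong)
    fix i j assume "j < n"
    then show "v i ^ m j = v i * v i ^ (m j - 1)"
      using m(1)[of j] by (simp add: power_eq_if)
  qed
  also have "\<dots> = (\<Prod>i<n. v i) * ?V"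
    by (rule fun_det_scale_rows)
  finally have "(\<integral>\<^sup>+t. kernel n (\<lambda>i. t (e i)) m * of_bool (linked (<) (>) Up n (\<lambda>i. t (e i)) v) \<partial>Pi\<^sub>M C (\<lambda>_. lborel))
      = ennreal ((\<Prod>i<n. v i) * ?V)"
    using kernel_integral[OF e, of Up v m] m True by simp
  moreover have "(\<Prod>i<n. form_weight White (v i)) = ennreal (\<Prod>i<n. 1 / v i)"
    using v by (subst prod_ennreal[symmetric]) (auto simp: form_weight_def intro!: prod.cong)
  moreover have "(\<Prod>i<n. 1 / v i) * ((\<Prod>i<n. v i) * ?V) = ?V"
  proof -
    have "(\<Prod>i<n. 1 / v i * v i) = 1"
      using v by (intro prod.neutral) force
    then show ?thesis
      by (simp only: mult.assoc[symmetric] prod.distrib[symmetric] mult_1_left)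
  qed
  moreover have "(\<Prod>j<n. inverse_power 1 (m j)) = ennreal (\<Prod>j<n. 1 / real (m j))"
    using m(1) by (subst prod_ennreal[symmetric]) (auto simp: inverse_power_def intro!: prod.cong)
  moreover have "kernel n v m = ennreal ((\<Prod>j<n. real (m j)) * ?V)"
    unfolding kernel_def fun_det_scale_cols using True by (rule if_P)
  moreover have "(\<Prod>j<n. 1 / real (m j)) * ((\<Prod>j<n. real (m j)) * ?V) = ?V"
  proof -
    have "(\<Prod>j<n. 1 / real (m j) * real (m j)) = 1"
      using m(1) by (intro prod.neutral) simp
    then show ?thesis
      by (simp only: mult.assoc[symmetric] prod.distrib[symmetric] mult_1_left)
  qed
  moreover have "0 \<le> (\<Prod>i<n. 1 / v i)" "0 \<le> (\<Prod>j<n. 1 / real (m j))"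
    using v by (auto intro!: prod_nonneg simp: less_imp_le)
  ultimately show ?thesis
    by (simp only: ennreal_mult'[symmetric])
next
  case False
  then have K: "kernel n v m = 0" by (auto simp: kernel_def)
  show ?thesis
  proof (cases "\<forall>i<n. 0 < v i \<and> v i < 1")
    case True
    then show ?thesis
      using kernel_integral[OF e, of Up v m] m K False by simp
  next
    case False
    then have "(\<Prod>i<n. form_weight White (v i)) = 0"
      by (intro prod_zero) (auto simp: form_weight_def)
    then show ?thesis by (simp add: K)
  qed
qed

lemma sigma_finite_PiM: "sigma_finite_measure N \<Longrightarrow> finite J \<Longrightarrow> sigma_finite_measure (Pi\<^sub>M J (\<lambda>_. N))"
proof -
  assume N: "sigma_finite_measure N" and "finite J"
  interpret sigma_finite_measure N by fact
  interpret finite_product_sigma_finite "\<lambda>_. N" J by standard fact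
  show ?thesis ..
qed

lemma represents_extend:
  assumes rep: "represents ks rs ds ws" and wp: "weakly_proper (ws @ [r])"
    and g: "g \<in> borel_measurable (Pi\<^sub>M (last_column (ws @ [r])) (\<lambda>_. lborel))"
  shows "(\<integral>\<^sup>+f. integral_weight (ds @ [d]) (ws @ [r]) f * g (restrict f (last_column (ws @ [r]))) \<partial>Pi\<^sub>M (L (ws @ [r])) (\<lambda>_. lborel))
    = (\<integral>\<^sup>+m. series_weight ks rs m * (\<integral>\<^sup>+v. (\<Prod>i<next_size r (width rs). form_weight d (v (point (ws @ [r]) i))) *
         (\<integral>\<^sup>+t. kernel (width rs) (\<lambda>i. t (point ws i)) (\<lambda>i. m (point rs i)) *
            of_bool (linked (<) (>) r (width rs) (\<lambda>i. t (point ws i)) (\<lambda>i. v (point (ws @ [r]) i)))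
            \<partial>Pi\<^sub>M (last_column ws) (\<lambda>_. lborel)) * g v
         \<partial>Pi\<^sub>M (last_column (ws @ [r])) (\<lambda>_. lborel)) \<partial>Pi\<^sub>M (L rs) (\<lambda>_. count_space UNIV))"
proof -
  let ?ws = "ws @ [r]"
  let ?C = "last_column ws" and ?C' = "last_column ?ws"
  let ?A = "\<lambda>v. \<Prod>p\<in>?C'. form_weight d (v p)"
  define Lk where "Lk t v = (of_bool (linked (<) (>) r (width rs) (\<lambda>i. t (point ws i)) (\<lambda>i. v (point ?ws i))) :: ennreal)"
    for t v :: "nat \<times> int \<Rightarrow> real"
  define G where "G t = (\<integral>\<^sup>+v. ?A v * (Lk t v * g v) \<partial>Pi\<^sub>M ?C' (\<lambda>_. lborel))" for t
  have w: "width ws = width rs" and len: "length ds = length ws + 1" and wpws: "weakly_proper ws"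
    using rep by (auto simp: represents_def width_def)
  interpret M1: sigma_finite_measure "Pi\<^sub>M ?C (\<lambda>_. lborel :: real measure)"
    by (rule sigma_finite_PiM) (auto intro: sigma_finite_lborel)
  interpret M2: sigma_finite_measure "Pi\<^sub>M ?C' (\<lambda>_. lborel :: real measure)"
    by (rule sigma_finite_PiM) (auto intro: sigma_finite_lborel)
  interpret pair_sigma_finite "Pi\<^sub>M ?C (\<lambda>_. lborel :: real measure)" "Pi\<^sub>M ?C' (\<lambda>_. lborel :: real measure)" ..
  let ?M = "Pi\<^sub>M ?C (\<lambda>_. lborel :: real measure) \<Otimes>\<^sub>M Pi\<^sub>M ?C' (\<lambda>_. lborel :: real measure)"
  have comp1: "(\<lambda>t. t (point ws i)) \<in> Pi\<^sub>M ?C (\<lambda>_. lborel) \<rightarrow>\<^sub>M (lborel :: real measure)" if "i < width rs" for i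
    using that by (intro measurable_component_singleton point_mem) (simp add: w)
  have comp2: "(\<lambda>v. v (point ?ws i)) \<in> Pi\<^sub>M ?C' (\<lambda>_. lborel) \<rightarrow>\<^sub>M (lborel :: real measure)" if "i < next_size r (width rs)" for i
    using that by (intro measurable_component_singleton point_mem) (simp add: width_snoc[OF wp] w)
  have Lk_joint: "(\<lambda>x. Lk (fst x) (snd x)) \<in> borel_measurable ?M"
    unfolding Lk_def
    by (intro borel_measurable_of_bool pred_linked[OF pred_less_lborel] measurable_compose[OF measurable_fst comp1]
        measurable_compose[OF measurable_snd comp2])
  have A: "?A \<in> borel_measurable (Pi\<^sub>M ?C' (\<lambda>_. lborel))"
    by (intro borel_measurable_prod_ennreal
        measurable_compose[OF measurable_component_singleton[where M = "\<lambda>_. lborel"] form_weight_measurable])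
  have AG: "(\<lambda>x. ?A (snd x) * (Lk (fst x) (snd x) * g (snd x))) \<in> borel_measurable ?M"
    by (intro borel_measurable_times_ennreal Lk_joint measurable_compose[OF measurable_snd A] measurable_compose[OF measurable_snd g])
  have G: "G \<in> borel_measurable (Pi\<^sub>M ?C (\<lambda>_. lborel))"
    unfolding G_def using M2.borel_measurable_nn_integral_fst[OF AG] by simp
  \<comment> \<open>\<open>represents\<close> evaluates the test function at the restriction to the
    last column, and \<open>linked\<close> reads only those values.\<close>
  have Gr: "G (restrict u ?C) = G u" for u
  proof -
    have "Lk (restrict u ?C) v = Lk u v" for v
      unfolding Lk_def by (intro arg_cong[where f = of_bool] linked_cong) (simp_all add: w)
    then show ?thesis by (simp add: G_def)
  qed
  have "(\<integral>\<^sup>+f. integral_weight (ds @ [d]) ?ws f * g (restrict f ?C') \<partial>Pi\<^sub>M (L ?ws) (\<lambda>_. lborel))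
      = (\<integral>\<^sup>+u. integral_weight (ds @ [d]) ws u * G u \<partial>Pi\<^sub>M (L ws) (\<lambda>_. lborel))"
    using weight_snoc_integral[OF sigma_finite_lborel wp pred_less_lborel form_weight_measurable g, of "\<lambda>x. (ds @ [d]) ! (x - 1)"]
    by (simp add: G_def Lk_def w len nth_append)
  also have "\<dots> = (\<integral>\<^sup>+u. integral_weight ds ws u * G (restrict u ?C) \<partial>Pi\<^sub>M (L ws) (\<lambda>_. lborel))"
  proof (rule nn_integral_cong)
    fix u
    have "integral_weight (ds @ [d]) ws u = integral_weight ds ws u"
      by (rule weight_cong) (auto simp: nth_append len)
    then show "integral_weight (ds @ [d]) ws u * G u = integral_weight ds ws u * G (restrict u ?C)"
      by (simp add: Gr)
  qed
  also have "\<dots> = (\<integral>\<^sup>+m. series_weight ks rs m *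
         (\<integral>\<^sup>+t. kernel (width rs) (\<lambda>i. t (point ws i)) (\<lambda>i. m (point rs i)) * G t
           \<partial>Pi\<^sub>M ?C (\<lambda>_. lborel)) \<partial>Pi\<^sub>M (L rs) (\<lambda>_. count_space UNIV))"
    using rep G unfolding represents_def by blast
  also have "\<dots> = (\<integral>\<^sup>+m. series_weight ks rs m * (\<integral>\<^sup>+v. (\<Prod>i<next_size r (width rs). form_weight d (v (point ?ws i))) *
         (\<integral>\<^sup>+t. kernel (width rs) (\<lambda>i. t (point ws i)) (\<lambda>i. m (point rs i)) * Lk t v \<partial>Pi\<^sub>M ?C (\<lambda>_. lborel)) * g v
         \<partial>Pi\<^sub>M ?C' (\<lambda>_. lborel)) \<partial>Pi\<^sub>M (L rs) (\<lambda>_. count_space UNIV))"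
  proof (rule nn_integral_cong, rule arg_cong2[where f = "(*)", OF refl])
    fix m
    let ?k = "\<lambda>t. kernel (width rs) (\<lambda>i. t (point ws i)) (\<lambda>i. m (point rs i))"
    have k: "?k \<in> borel_measurable (Pi\<^sub>M ?C (\<lambda>_. lborel))"
      using comp1 by (intro kernel_measurable) simp
    have kAG: "(\<lambda>x. ?k (fst x) * (?A (snd x) * (Lk (fst x) (snd x) * g (snd x)))) \<in> borel_measurable ?M"
      by (intro borel_measurable_times_ennreal AG measurable_compose[OF measurable_fst k])
    have sec: "(\<lambda>v. Lk t v) \<in> borel_measurable (Pi\<^sub>M ?C' (\<lambda>_. lborel))" if "t \<in> space (Pi\<^sub>M ?C (\<lambda>_. lborel))" for t
      using measurable_compose[OF measurable_Pair1'[OF that] Lk_joint] by simp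
    have sec2: "(\<lambda>t. Lk t v) \<in> borel_measurable (Pi\<^sub>M ?C (\<lambda>_. lborel))" if "v \<in> space (Pi\<^sub>M ?C' (\<lambda>_. lborel))" for v
      using measurable_compose[OF measurable_Pair2'[OF that] Lk_joint] by simp
    have "(\<integral>\<^sup>+t. ?k t * G t \<partial>Pi\<^sub>M ?C (\<lambda>_. lborel))
        = (\<integral>\<^sup>+t. \<integral>\<^sup>+v. ?k t * (?A v * (Lk t v * g v)) \<partial>Pi\<^sub>M ?C' (\<lambda>_. lborel) \<partial>Pi\<^sub>M ?C (\<lambda>_. lborel))"
      unfolding G_def
      by (intro nn_integral_cong nn_integral_cmult[symmetric] borel_measurable_times_ennreal A g sec)
    also have "\<dots> = (\<integral>\<^sup>+v. \<integral>\<^sup>+t. ?k t * (?A v * (Lk t v * g v)) \<partial>Pi\<^sub>M ?C (\<lambda>_. lborel) \<partial>Pi\<^sub>M ?C' (\<lambda>_. lborel))"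
      using kAG by (intro Fubini'[symmetric]) (simp add: case_prod_beta)
    also have "\<dots> = (\<integral>\<^sup>+v. (\<Prod>i<next_size r (width rs). form_weight d (v (point ?ws i))) *
         (\<integral>\<^sup>+t. ?k t * Lk t v \<partial>Pi\<^sub>M ?C (\<lambda>_. lborel)) * g v \<partial>Pi\<^sub>M ?C' (\<lambda>_. lborel))"
    proof (rule nn_integral_cong)
      fix v assume v: "v \<in> space (Pi\<^sub>M ?C' (\<lambda>_. lborel :: real measure))"
      have "?A v = (\<Prod>i<next_size r (width rs). form_weight d (v (point ?ws i)))"
        using prod.reindex_bij_betw[OF bij_betw_point[of ?ws], of "\<lambda>p. form_weight d (v p)"]
        by (simp add: width_snoc[OF wp] w)
      moreover have "(\<integral>\<^sup>+t. ?k t * (?A v * (Lk t v * g v)) \<partial>Pi\<^sub>M ?C (\<lambda>_. lborel))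
          = (\<integral>\<^sup>+t. (?A v * g v) * (?k t * Lk t v) \<partial>Pi\<^sub>M ?C (\<lambda>_. lborel))"
        by (simp only: mult_ac)
      moreover have "\<dots> = (?A v * g v) * (\<integral>\<^sup>+t. ?k t * Lk t v \<partial>Pi\<^sub>M ?C (\<lambda>_. lborel))"
        by (intro nn_integral_cmult borel_measurable_times_ennreal k sec2 v)
      ultimately show "(\<integral>\<^sup>+t. ?k t * (?A v * (Lk t v * g v)) \<partial>Pi\<^sub>M ?C (\<lambda>_. lborel))
          = (\<Prod>i<next_size r (width rs). form_weight d (v (point ?ws i))) *
         (\<integral>\<^sup>+t. ?k t * Lk t v \<partial>Pi\<^sub>M ?C (\<lambda>_. lborel)) * g v"
        by (simp only: mult_ac)
    qed
    finally show "(\<integral>\<^sup>+t. ?k t * G t \<partial>Pi\<^sub>M ?C (\<lambda>_. lborel)) = (\<integral>\<^sup>+v. (\<Prod>i<next_size r (width rs). form_weight d (v (point ?ws i))) *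
         (\<integral>\<^sup>+t. ?k t * Lk t v \<partial>Pi\<^sub>M ?C (\<lambda>_. lborel)) * g v \<partial>Pi\<^sub>M ?C' (\<lambda>_. lborel))" .
  qed
  finally show ?thesis
    unfolding Lk_def .
qed

text \<open>In essence 1 / (1 - t) is the sum of (1 / l) * l t^(l-1) over l \<ge> 1.\<close>

lemma represents_Nil: "represents [1] [] [Black] []"
  unfolding represents_def
proof (intro conjI ballI)
  show "weakly_proper []" "weakly_proper []"
    by (simp_all add: weakly_proper_def)
  fix g :: "(nat \<times> int \<Rightarrow> real) \<Rightarrow> ennreal" assume g: "g \<in> borel_measurable (Pi\<^sub>M (last_column []) (\<lambda>_. lborel :: real measure))"
  let ?C = "last_column []"
  have w: "width [] = Suc 0" by (simp add: width_def)
  have compat: "compatible R1 R2 [] f" for R1 R2 and f :: "nat \<times> int \<Rightarrow> 'z"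
    unfolding compatible_def by (auto simp: L_def)
  have prod: "(\<Prod>p\<in>?C. h p) = h (point [] 0)" for h :: "nat \<times> int \<Rightarrow> ennreal"
    by (simp add: last_column_def w lessThan_Suc)
  let ?S = "\<lambda>l. (\<Prod>c\<in>?C. inverse_power 1 (l c))"
  let ?k = "\<lambda>v l. kernel 1 (\<lambda>i. v (point [] i)) (\<lambda>i. l (point [] i))"
  \<comment> \<open>The first column arises as an \<open>Op\<close> step from an empty column:
    \<open>next_size Op 0\<close> is 1, the kernel of size 0 is 1, and there are no linking
    conditions.\<close>
  have bij: "bij_betw (\<lambda>i. i) {..<0::nat} {}" "bij_betw (point []) {..<next_size Op 0} ?C"
    using bij_betw_point[of "[]"] by (simp_all add: w bij_betw_def)
  have lin: "linked R1 R2 r 0 u v" for R1 R2 r and u v :: "nat \<Rightarrow> 'z"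
    by (simp add: linked_def)
  have kernel0: "kernel 0 t m = 1" for t m
    by (simp add: kernel_def increasing_def)
  have key: "form_weight Black (v (point [] 0)) = (\<integral>\<^sup>+l. ?S l * ?k v l \<partial>Pi\<^sub>M ?C (\<lambda>_. count_space UNIV))" for v
    using kernel_transition_black[OF bij, of "\<lambda>_. 1" "\<lambda>i. v (point [] i)"]
    by (simp add: kernel0 lin increasing_def PiM_empty)
  have kg: "(\<lambda>t. ?k t l * g t) \<in> borel_measurable (Pi\<^sub>M ?C (\<lambda>_. lborel))" for l
    by (intro borel_measurable_times_ennreal g kernel_measurable) (simp add: w)
  have "(\<integral>\<^sup>+u. integral_weight [Black] [] u * g (restrict u ?C) \<partial>Pi\<^sub>M (L []) (\<lambda>_. lborel))
      = (\<integral>\<^sup>+u. (\<integral>\<^sup>+l. ?S l * (?k u l * g u) \<partial>Pi\<^sub>M ?C (\<lambda>_. count_space UNIV)) \<partial>Pi\<^sub>M ?C (\<lambda>_. lborel))"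
    unfolding L_Nil
  proof (rule nn_integral_cong)
    fix u assume u: "u \<in> space (Pi\<^sub>M ?C (\<lambda>_. lborel :: real measure))"
    then have "restrict u ?C = u"
      by (auto simp: space_PiM PiE_iff extensional_restrict)
    moreover have "integral_weight [Black] [] u = form_weight Black (u (point [] 0))"
      unfolding weight_def L_Nil by (simp add: compat prod point_def)
    ultimately have "integral_weight [Black] [] u * g (restrict u ?C)
        = (\<integral>\<^sup>+l. ?S l * ?k u l \<partial>Pi\<^sub>M ?C (\<lambda>_. count_space UNIV)) * g u"
      by (simp only: key)
    also have "\<dots> = (\<integral>\<^sup>+l. ?S l * ?k u l * g u \<partial>Pi\<^sub>M ?C (\<lambda>_. count_space UNIV))"
      by (intro nn_integral_multc[symmetric] measurable_PiM_count_space) simp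
    finally show "integral_weight [Black] [] u * g (restrict u ?C)
        = (\<integral>\<^sup>+l. ?S l * (?k u l * g u) \<partial>Pi\<^sub>M ?C (\<lambda>_. count_space UNIV))"
      by (simp only: mult.assoc)
  qed
  also have "\<dots> = (\<integral>\<^sup>+l. (\<integral>\<^sup>+u. ?S l * (?k u l * g u) \<partial>Pi\<^sub>M ?C (\<lambda>_. lborel)) \<partial>Pi\<^sub>M ?C (\<lambda>_. count_space UNIV))"
    by (intro nn_integral_swap_count borel_measurable_times_ennreal[OF borel_measurable_const kg]) simp
  also have "\<dots> = (\<integral>\<^sup>+l. series_weight [1] [] l * (\<integral>\<^sup>+u. ?k u l * g u \<partial>Pi\<^sub>M ?C (\<lambda>_. lborel)) \<partial>Pi\<^sub>M ?C (\<lambda>_. count_space UNIV))"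
  proof (rule nn_integral_cong)
    fix l
    have "series_weight [1] [] l = ?S l"
      unfolding weight_def L_Nil by (simp add: compat prod point_def)
    then show "(\<integral>\<^sup>+u. ?S l * (?k u l * g u) \<partial>Pi\<^sub>M ?C (\<lambda>_. lborel))
        = series_weight [1] [] l * (\<integral>\<^sup>+u. ?k u l * g u \<partial>Pi\<^sub>M ?C (\<lambda>_. lborel))"
      by (simp only: nn_integral_cmult[OF kg])
  qed
  finally show "(\<integral>\<^sup>+u. integral_weight [Black] [] u * g (restrict u ?C) \<partial>Pi\<^sub>M (L []) (\<lambda>_. lborel))
     = (\<integral>\<^sup>+m. series_weight [1] [] m *
         (\<integral>\<^sup>+t. kernel (width []) (\<lambda>i. t (point [] i)) (\<lambda>i. m (point [] i)) * g t
           \<partial>Pi\<^sub>M ?C (\<lambda>_. lborel)) \<partial>Pi\<^sub>M (L []) (\<lambda>_. count_space UNIV))"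
    by (simp add: w L_Nil)
qed simp_all

text \<open>A black letter adds a column on both sides: its geometric sums become a new column of
  the series with exponent 1.\<close>

lemma represents_black:
  assumes rep: "represents ks rs ds ws" and wp: "weakly_proper (rs @ [r])"
  shows "represents (ks @ [1]) (rs @ [r]) (ds @ [Black]) (ws @ [r])"
  unfolding represents_def
proof (intro conjI ballI)
  let ?rs = "rs @ [r]" and ?ws = "ws @ [r]"
  let ?C = "last_column ws" and ?C' = "last_column ?ws" and ?D' = "last_column ?rs"
  have facts: "weakly_proper rs" "weakly_proper ws" "E ws = E rs" "length ks = length rs + 1" "length ds = length ws + 1"
    using rep by (auto simp: represents_def)
  show wprs: "weakly_proper ?rs" by fact
  show wpws: "weakly_proper ?ws"
    using wp facts by (simp add: weakly_proper_snoc)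
  show "E ?ws = E ?rs" "length (ks @ [1]) = length ?rs + 1" "length (ds @ [Black]) = length ?ws + 1"
    using facts by simp_all
  have w: "width ws = width rs" "width ?ws = next_size r (width rs)" "width ?rs = next_size r (width rs)"
    using facts width_snoc[OF wp] width_snoc[OF wpws] by (simp_all add: width_def)
  have wpos: "0 < width rs" using facts(1) by (rule width_pos)
  have bij: "bij_betw (point ws) {..<width rs} ?C" "bij_betw (point ?rs) {..<next_size r (width rs)} ?D'"
    using bij_betw_point[of ws] bij_betw_point[of ?rs] by (simp_all only: w)
  fix g :: "(nat \<times> int \<Rightarrow> real) \<Rightarrow> ennreal" assume g: "g \<in> borel_measurable (Pi\<^sub>M ?C' (\<lambda>_. lborel :: real measure))"
  let ?S = "\<lambda>l. \<Prod>c\<in>?D'. inverse_power 1 (l c)"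
  let ?lk = "\<lambda>m l. (of_bool (linked (<) (\<ge>) r (width rs) (\<lambda>i. m (point rs i)) (\<lambda>j. l (point ?rs j))) :: ennreal)"
  let ?k = "\<lambda>v l. kernel (next_size r (width rs)) (\<lambda>i. v (point ?ws i)) (\<lambda>j. l (point ?rs j))"
  let ?G = "\<lambda>l. \<integral>\<^sup>+v. ?k v l * g v \<partial>Pi\<^sub>M ?C' (\<lambda>_. lborel)"
  have k: "(\<lambda>v. ?k v l) \<in> borel_measurable (Pi\<^sub>M ?C' (\<lambda>_. lborel))" for l
    by (intro kernel_measurable) (simp add: w)
  have G_restrict: "?G (restrict m ?D') = ?G m" for m
    by (intro nn_integral_cong arg_cong2[where f = "(*)"] kernel_cong refl) (simp add: w)
  have "(\<integral>\<^sup>+f. integral_weight (ds @ [Black]) ?ws f * g (restrict f ?C') \<partial>Pi\<^sub>M (L ?ws) (\<lambda>_. lborel))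
    = (\<integral>\<^sup>+m. series_weight ks rs m * (\<integral>\<^sup>+l. ?S l * (?lk m l * ?G l) \<partial>Pi\<^sub>M ?D' (\<lambda>_. count_space UNIV)) \<partial>Pi\<^sub>M (L rs) (\<lambda>_. count_space UNIV))"
    unfolding represents_extend[OF rep wpws g]
  proof (rule nn_integral_cong)
    fix m :: "nat \<times> int \<Rightarrow> nat"
    let ?K = "\<lambda>v. \<integral>\<^sup>+t. kernel (width rs) (\<lambda>i. t (point ws i)) (\<lambda>i. m (point rs i)) *
            of_bool (linked (<) (>) r (width rs) (\<lambda>i. t (point ws i)) (\<lambda>i. v (point ?ws i)))
            \<partial>Pi\<^sub>M ?C (\<lambda>_. lborel)"
    show "series_weight ks rs m * (\<integral>\<^sup>+v. (\<Prod>i<next_size r (width rs). form_weight Black (v (point ?ws i))) * ?K v * g v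
         \<partial>Pi\<^sub>M ?C' (\<lambda>_. lborel))
      = series_weight ks rs m * (\<integral>\<^sup>+l. ?S l * (?lk m l * ?G l) \<partial>Pi\<^sub>M ?D' (\<lambda>_. count_space UNIV))"
    proof (cases "series_weight ks rs m = 0")
      case False
      note m = series_weight_nonzero(2,3)[OF facts(1) False]
      have "(\<integral>\<^sup>+v. (\<Prod>i<next_size r (width rs). form_weight Black (v (point ?ws i))) * ?K v * g v \<partial>Pi\<^sub>M ?C' (\<lambda>_. lborel))
        = (\<integral>\<^sup>+v. (\<integral>\<^sup>+l. ?S l * (?lk m l * (?k v l * g v)) \<partial>Pi\<^sub>M ?D' (\<lambda>_. count_space UNIV)) \<partial>Pi\<^sub>M ?C' (\<lambda>_. lborel))"
      proof (rule nn_integral_cong)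
        fix v :: "nat \<times> int \<Rightarrow> real"
        have "(\<Prod>i<next_size r (width rs). form_weight Black (v (point ?ws i))) * ?K v
            = (\<integral>\<^sup>+l. ?S l * (?lk m l * ?k v l) \<partial>Pi\<^sub>M ?D' (\<lambda>_. count_space UNIV))"
          by (rule kernel_transition_black[OF bij m]) (use wpos in auto)
        then have "(\<Prod>i<next_size r (width rs). form_weight Black (v (point ?ws i))) * ?K v * g v
            = (\<integral>\<^sup>+l. ?S l * (?lk m l * ?k v l) \<partial>Pi\<^sub>M ?D' (\<lambda>_. count_space UNIV)) * g v"
          by (simp only:)
        also have "\<dots> = (\<integral>\<^sup>+l. ?S l * (?lk m l * ?k v l) * g v \<partial>Pi\<^sub>M ?D' (\<lambda>_. count_space UNIV))"
          by (intro nn_integral_multc[symmetric] measurable_PiM_count_space) simp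
        finally show "(\<Prod>i<next_size r (width rs). form_weight Black (v (point ?ws i))) * ?K v * g v
            = (\<integral>\<^sup>+l. ?S l * (?lk m l * (?k v l * g v)) \<partial>Pi\<^sub>M ?D' (\<lambda>_. count_space UNIV))"
          by (simp only: mult.assoc)
      qed
      also have "\<dots> = (\<integral>\<^sup>+l. (\<integral>\<^sup>+v. ?S l * (?lk m l * (?k v l * g v)) \<partial>Pi\<^sub>M ?C' (\<lambda>_. lborel)) \<partial>Pi\<^sub>M ?D' (\<lambda>_. count_space UNIV))"
        by (intro nn_integral_swap_count borel_measurable_times_ennreal borel_measurable_const k g) simp
      also have "\<dots> = (\<integral>\<^sup>+l. ?S l * (?lk m l * ?G l) \<partial>Pi\<^sub>M ?D' (\<lambda>_. count_space UNIV))"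
      proof (rule nn_integral_cong)
        fix l
        have "(\<integral>\<^sup>+v. (?S l * ?lk m l) * (?k v l * g v) \<partial>Pi\<^sub>M ?C' (\<lambda>_. lborel)) = (?S l * ?lk m l) * ?G l"
          by (intro nn_integral_cmult borel_measurable_times_ennreal k g)
        then show "(\<integral>\<^sup>+v. ?S l * (?lk m l * (?k v l * g v)) \<partial>Pi\<^sub>M ?C' (\<lambda>_. lborel)) = ?S l * (?lk m l * ?G l)"
          by (simp only: mult.assoc)
      qed
      finally show ?thesis by (simp only:)
    qed simp
  qed
  also have "\<dots> = (\<integral>\<^sup>+m. series_weight (ks @ [1]) rs m * (\<integral>\<^sup>+l. ?S l * (?lk m l * ?G l) \<partial>Pi\<^sub>M ?D' (\<lambda>_. count_space UNIV)) \<partial>Pi\<^sub>M (L rs) (\<lambda>_. count_space UNIV))"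
  proof (rule nn_integral_cong)
    fix m
    have "series_weight ks rs m = series_weight (ks @ [1]) rs m"
      by (rule weight_cong) (auto simp: nth_append facts)
    then show "series_weight ks rs m * (\<integral>\<^sup>+l. ?S l * (?lk m l * ?G l) \<partial>Pi\<^sub>M ?D' (\<lambda>_. count_space UNIV))
        = series_weight (ks @ [1]) rs m * (\<integral>\<^sup>+l. ?S l * (?lk m l * ?G l) \<partial>Pi\<^sub>M ?D' (\<lambda>_. count_space UNIV))"
      by (simp only:)
  qed
  \<comment> \<open>The splitting off of the last column is read backwards here, with the counting
    measure.\<close>
  also have "\<dots> = (\<integral>\<^sup>+m. series_weight (ks @ [1]) ?rs m * ?G (restrict m ?D') \<partial>Pi\<^sub>M (L ?rs) (\<lambda>_. count_space UNIV))"
    using weight_snoc_integral[OF sigma_finite_measure_count_space wp pred_count_space pred_count_space,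
        of "\<lambda>x. inverse_power ((ks @ [1]) ! (x - 1))" ?G]
    by (simp add: measurable_PiM_count_space nth_append facts)
  finally show "(\<integral>\<^sup>+u. integral_weight (ds @ [Black]) ?ws u * g (restrict u ?C') \<partial>Pi\<^sub>M (L ?ws) (\<lambda>_. lborel))
     = (\<integral>\<^sup>+m. series_weight (ks @ [1]) ?rs m *
         (\<integral>\<^sup>+t. kernel (width ?rs) (\<lambda>i. t (point ?ws i)) (\<lambda>i. m (point ?rs i)) * g t
           \<partial>Pi\<^sub>M ?C' (\<lambda>_. lborel)) \<partial>Pi\<^sub>M (L ?rs) (\<lambda>_. count_space UNIV))"
    unfolding G_restrict w .
qed

lemma inverse_power_mult: "inverse_power k a * inverse_power 1 a = inverse_power (Suc k) a"
  by (auto simp: inverse_power_def ennreal_mult'[symmetric])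

lemma series_weight_increment:
  assumes wp: "weakly_proper rs" and len: "length ks = length rs"
  shows "series_weight (ks @ [k]) rs m * (\<Prod>j<width rs. inverse_power 1 (m (point rs j)))
    = series_weight (ks @ [Suc k]) rs m"
proof -
  let ?C = "last_column rs"
  have split: "(\<Prod>p\<in>L rs. f p) = (\<Prod>p\<in>L rs - ?C. f p) * (\<Prod>p\<in>?C. f p)" for f :: "nat \<times> int \<Rightarrow> ennreal"
    by (rule prod.subset_diff[OF last_column_subset[OF wp] finite_L[OF wp]])
  have "(\<Prod>p\<in>L rs - ?C. inverse_power ((ks @ [k]) ! (fst p - 1)) (m p))
      = (\<Prod>p\<in>L rs - ?C. inverse_power ((ks @ [Suc k]) ! (fst p - 1)) (m p))"
  proof (rule prod.cong)
    fix p assume p: "p \<in> L rs - ?C"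
    then have "fst p \<noteq> length rs + 1"
      using mem_L_last[OF wp, of "snd p"] by (cases p) auto
    with p L_fst[of p rs] have "fst p - 1 < length ks"
      unfolding len by auto
    then show "inverse_power ((ks @ [k]) ! (fst p - 1)) (m p) = inverse_power ((ks @ [Suc k]) ! (fst p - 1)) (m p)"
      by (simp add: nth_append)
  qed simp
  moreover have "(\<Prod>p\<in>?C. inverse_power ((ks @ [k]) ! (fst p - 1)) (m p)) * (\<Prod>p\<in>?C. inverse_power 1 (m p))
      = (\<Prod>p\<in>?C. inverse_power ((ks @ [Suc k]) ! (fst p - 1)) (m p))"
    unfolding prod.distrib[symmetric]
  proof (rule prod.cong)
    fix p assume "p \<in> ?C"
    then have "fst p - 1 = length ks"
      using last_column_fst[of p rs] len by simp
    then show "inverse_power ((ks @ [k]) ! (fst p - 1)) (m p) * inverse_power 1 (m p)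
        = inverse_power ((ks @ [Suc k]) ! (fst p - 1)) (m p)"
      by (simp only: nth_append_length inverse_power_mult)
  qed simp
  moreover have "(\<Prod>p\<in>?C. inverse_power 1 (m p)) = (\<Prod>j<width rs. inverse_power 1 (m (point rs j)))"
    using prod.reindex_bij_betw[OF bij_betw_point[of rs], of "\<lambda>p. inverse_power 1 (m p)"] by simp
  ultimately show ?thesis
    unfolding weight_def split by (simp only: mult.assoc)
qed

text \<open>The symbol sequence of the series stays the same while the poset gains a column; the
  resulting factors \<open>1 / m\<close> are absorbed by raising the last exponent.\<close>

lemma represents_white:
  assumes rep: "represents (ks @ [k]) rs ds ws"
  shows "represents (ks @ [Suc k]) rs (ds @ [White]) (ws @ [Up])"
  unfolding represents_def
proof (intro conjI ballI)
  let ?ws = "ws @ [Up]"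
  let ?C = "last_column ws" and ?C' = "last_column ?ws"
  have facts: "weakly_proper rs" "weakly_proper ws" "E ws = E rs" "length (ks @ [k]) = length rs + 1" "length ds = length ws + 1"
    using rep by (auto simp: represents_def)
  show "weakly_proper rs" by fact
  show wpws: "weakly_proper ?ws"
    using facts weakly_proper_E_nonneg[of ws] by (simp add: weakly_proper_snoc)
  show "E ?ws = E rs" "length (ks @ [Suc k]) = length rs + 1" "length (ds @ [White]) = length ?ws + 1"
    using facts by simp_all
  have w: "width ws = width rs" "width ?ws = width rs"
    using facts by (simp_all add: width_def)
  have bij: "bij_betw (point ws) {..<width rs} ?C"
    using bij_betw_point[of ws] by (simp only: w)
  fix g :: "(nat \<times> int \<Rightarrow> real) \<Rightarrow> ennreal" assume g: "g \<in> borel_measurable (Pi\<^sub>M ?C' (\<lambda>_. lborel :: real measure))"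
  let ?k = "\<lambda>m v. kernel (width rs) (\<lambda>i. v (point ?ws i)) (\<lambda>j. m (point rs j))"
  have k: "?k m \<in> borel_measurable (Pi\<^sub>M ?C' (\<lambda>_. lborel))" for m
    by (intro kernel_measurable) (simp add: w)
  show "(\<integral>\<^sup>+f. integral_weight (ds @ [White]) ?ws f * g (restrict f ?C') \<partial>Pi\<^sub>M (L ?ws) (\<lambda>_. lborel))
    = (\<integral>\<^sup>+m. series_weight (ks @ [Suc k]) rs m * (\<integral>\<^sup>+v. ?k m v * g v \<partial>Pi\<^sub>M ?C' (\<lambda>_. lborel)) \<partial>Pi\<^sub>M (L rs) (\<lambda>_. count_space UNIV))"
    unfolding represents_extend[OF rep wpws g]
  proof (rule nn_integral_cong)
    fix m :: "nat \<times> int \<Rightarrow> nat"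
    let ?K = "\<lambda>v. \<integral>\<^sup>+t. kernel (width rs) (\<lambda>i. t (point ws i)) (\<lambda>i. m (point rs i)) *
            of_bool (linked (<) (>) Up (width rs) (\<lambda>i. t (point ws i)) (\<lambda>i. v (point ?ws i)))
            \<partial>Pi\<^sub>M ?C (\<lambda>_. lborel)"
    let ?p = "\<Prod>j<width rs. inverse_power 1 (m (point rs j))"
    show "series_weight (ks @ [k]) rs m * (\<integral>\<^sup>+v. (\<Prod>i<next_size Up (width rs). form_weight White (v (point ?ws i))) * ?K v * g v
         \<partial>Pi\<^sub>M ?C' (\<lambda>_. lborel))
      = series_weight (ks @ [Suc k]) rs m * (\<integral>\<^sup>+v. ?k m v * g v \<partial>Pi\<^sub>M ?C' (\<lambda>_. lborel))"
    proof (cases "series_weight (ks @ [k]) rs m = 0")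
      case True
      moreover have "series_weight (ks @ [Suc k]) rs m = 0"
        using series_weight_increment[OF facts(1), of ks k m] facts(4) True by simp
      ultimately show ?thesis by simp
    next
      case False
      note m = series_weight_nonzero(2,3)[OF facts(1) False]
      have "(\<integral>\<^sup>+v. (\<Prod>i<next_size Up (width rs). form_weight White (v (point ?ws i))) * ?K v * g v \<partial>Pi\<^sub>M ?C' (\<lambda>_. lborel))
        = (\<integral>\<^sup>+v. ?p * (?k m v * g v) \<partial>Pi\<^sub>M ?C' (\<lambda>_. lborel))"
      proof (rule nn_integral_cong)
        fix v :: "nat \<times> int \<Rightarrow> real"
        have "(\<Prod>i<next_size Up (width rs). form_weight White (v (point ?ws i))) * ?K v = ?p * ?k m v"
          unfolding next_size.simps by (rule kernel_transition_white[OF bij m])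
        then show "(\<Prod>i<next_size Up (width rs). form_weight White (v (point ?ws i))) * ?K v * g v = ?p * (?k m v * g v)"
          by (simp only: mult.assoc)
      qed
      also have "\<dots> = ?p * (\<integral>\<^sup>+v. ?k m v * g v \<partial>Pi\<^sub>M ?C' (\<lambda>_. lborel))"
        by (intro nn_integral_cmult borel_measurable_times_ennreal k g)
      finally show ?thesis
        using series_weight_increment[OF facts(1), of ks k m] facts(4) by (simp add: mult.assoc[symmetric])
    qed
  qed
qed

section \<open>The whole word and the value of its integral\<close>

lemma word_marks_black: "word_marks (ks @ [1]) = word_marks ks @ [Black]"
  by (simp add: word_marks_def)

lemma word_marks_white: "0 < k \<Longrightarrow> word_marks (ks @ [Suc k]) = word_marks (ks @ [k]) @ [White]"
  by (cases k) (simp_all add: word_marks_def replicate_append_same)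

lemma word_steps_white:
  "0 < k \<Longrightarrow> length ks = length rs \<Longrightarrow> word_steps (ks @ [Suc k]) rs = word_steps (ks @ [k]) rs @ [Up]"
  by (cases k) (simp_all add: word_steps_def replicate_append_same zip_append1)

text \<open>The former last block moves from the separately appended tail into the part built by
  \<open>map2\<close>, where it is followed by \<open>r\<close>; the new last block, of exponent 1,
  contributes no symbols.\<close>

lemma word_steps_black:
  assumes "length ks = length rs + 1"
  shows "word_steps (ks @ [1]) (rs @ [r]) = word_steps ks rs @ [r]"
proof -
  obtain ks' k where ks: "ks = ks' @ [k]" using assms by (cases ks rule: rev_cases) auto
  with assms have len: "length ks' = length rs" by simp
  have "zip (ks' @ [k, 1]) (rs @ [r]) = zip ks' rs @ [(k, r)]"
    using len by (simp add: zip_append1)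
  moreover have "zip (ks' @ [k]) rs = zip ks' rs"
    using len by (simp add: zip_append1)
  ultimately show ?thesis
    by (simp add: word_steps_def ks)
qed

lemma represents_word:
  assumes "weakly_proper rs" "length ks = length rs + 1" "\<forall>k\<in>set ks. 0 < k"
  shows "represents ks rs (word_marks ks) (word_steps ks rs)"
  using assms
proof (induction rs arbitrary: ks rule: rev_induct)
  \<comment> \<open>Each block starts with a black letter and exponent 1; every further white letter
    raises the exponent by one.\<close>
  have extend: "represents (ks @ [k]) rs (word_marks (ks @ [k])) (word_steps (ks @ [k]) rs)"
    if "represents (ks @ [1]) rs (word_marks (ks @ [1])) (word_steps (ks @ [1]) rs)" "0 < k" "length ks = length rs"
    for ks k rs
    using that(2)
  proof (induction k rule: nat_induct_non_zero)
    case (Suc k)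
    then show ?case
      using represents_white[OF Suc.IH] that(3) by (simp add: word_marks_white word_steps_white)
  qed (use that(1) in simp)
  {
    case Nil
    then obtain k where "ks = [] @ [k]" "0 < k"
      by (cases ks) auto
    then show ?case
      using extend[of "[]" "[]" k] represents_Nil by (simp add: word_marks_def word_steps_def)
  next
    case (snoc r rs)
    then obtain ks' k where ks: "ks = ks' @ [k]" by (cases ks rule: rev_cases) auto
    have "represents ks' rs (word_marks ks') (word_steps ks' rs)"
      using snoc.prems by (intro snoc.IH) (auto simp: ks weakly_proper_snoc)
    then have "represents (ks' @ [1]) (rs @ [r]) (word_marks ks' @ [Black]) (word_steps ks' rs @ [r])"
      using snoc.prems(1) by (rule represents_black)
    moreover have "length ks' = length rs + 1"
      using snoc.prems(2) by (simp add: ks)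
    ultimately have "represents (ks' @ [1]) (rs @ [r]) (word_marks (ks' @ [1])) (word_steps (ks' @ [1]) (rs @ [r]))"
      by (simp only: word_marks_black word_steps_black)
    then show ?case
      using extend[of ks' "rs @ [r]" k] snoc.prems by (simp add: ks)
  }
qed

text \<open>The test function is the constant 1. For proper \<open>rs\<close> the last column has a
  single entry, and its kernel is a probability density.\<close>

lemma integral_weight_eq_series_weight:
  assumes rep: "represents ks rs ds ws" and "proper rs"
  shows "(\<integral>\<^sup>+u. integral_weight ds ws u \<partial>Pi\<^sub>M (L ws) (\<lambda>_. lborel))
    = (\<integral>\<^sup>+m. series_weight ks rs m \<partial>Pi\<^sub>M (L rs) (\<lambda>_. count_space UNIV))"
proof -
  let ?C = "last_column ws"
  have w: "width rs = 1" "width ws = 1" and wp: "weakly_proper rs"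
    using assms by (simp_all add: width_def represents_def proper_def)
  have bij: "bij_betw (point ws) {..<1} ?C"
    using bij_betw_point[of ws] by (simp add: w)
  have "(\<integral>\<^sup>+u. integral_weight ds ws u * 1 \<partial>Pi\<^sub>M (L ws) (\<lambda>_. lborel))
     = (\<integral>\<^sup>+m. series_weight ks rs m *
         (\<integral>\<^sup>+t. kernel (width rs) (\<lambda>i. t (point ws i)) (\<lambda>i. m (point rs i)) * 1
           \<partial>Pi\<^sub>M ?C (\<lambda>_. lborel)) \<partial>Pi\<^sub>M (L rs) (\<lambda>_. count_space UNIV))"
    using rep[unfolded represents_def, THEN conjunct2, THEN conjunct2, THEN conjunct2, THEN conjunct2, THEN conjunct2,
        rule_format, of "\<lambda>_. 1"] by simp
  also have "\<dots> = (\<integral>\<^sup>+m. series_weight ks rs m \<partial>Pi\<^sub>M (L rs) (\<lambda>_. count_space UNIV))"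
  proof (rule nn_integral_cong)
    fix m
    show "series_weight ks rs m * (\<integral>\<^sup>+t. kernel (width rs) (\<lambda>i. t (point ws i)) (\<lambda>i. m (point rs i)) * 1
           \<partial>Pi\<^sub>M ?C (\<lambda>_. lborel)) = series_weight ks rs m"
    proof (cases "series_weight ks rs m = 0")
      case False
      note m = series_weight_nonzero(2,3)[OF wp False, unfolded w]
      \<comment> \<open>A fictitious \<open>Cl\<close> step leads from one point to an empty column
        and imposes no condition, so \<open>kernel_integral\<close> yields the integral over the
        whole interval, with endpoints 0 and 1. The constant function 0 is a placeholder for the
        empty column.\<close>
      have "linked (<) (>) Cl 1 u v" for u v :: "nat \<Rightarrow> real"
        by (simp add: linked_def)
      then have "(\<integral>\<^sup>+t. kernel 1 (\<lambda>i. t (point ws i)) (\<lambda>i. m (point rs i)) \<partial>Pi\<^sub>M ?C (\<lambda>_. lborel))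
          = ennreal (fun_det 1 (\<lambda>i j. above Cl 1 (\<lambda>_. 0) i ^ m (point rs j) - below Cl (\<lambda>_. 0) i ^ m (point rs j)))"
        using kernel_integral[OF bij, of Cl "\<lambda>_. 0" "\<lambda>i. m (point rs i)"] m by (simp add: increasing_def)
      also have "\<dots> = 1"
        using m(1)[of 0] by (simp add: fun_det_leibniz above_def below_def)
      finally show ?thesis
        by (simp add: w)
    qed simp
  qed
  finally show ?thesis by simp
qed

section \<open>From nonnegative integrals to Bochner integrals\<close>

lemma AE_PiM_lborel_neq:
  assumes "finite J" "p \<in> J"
  shows "AE t in Pi\<^sub>M J (\<lambda>_. lborel :: real measure). t p \<noteq> c"
proof (rule AE_I')
  interpret product_sigma_finite "\<lambda>_. lborel :: real measure"
    by (intro product_sigma_finite.intro sigma_finite_lborel)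
  let ?A = "\<lambda>i. if i = p then {c} else UNIV"
  have "emeasure (Pi\<^sub>M J (\<lambda>_. lborel :: real measure)) (Pi\<^sub>E J ?A) = (\<Prod>i\<in>J. emeasure lborel (?A i))"
    using assms by (intro emeasure_PiM) auto
  also have "\<dots> = 0"
    using assms by (intro prod_zero bexI[of _ p]) auto
  finally show "Pi\<^sub>E J ?A \<in> null_sets (Pi\<^sub>M J (\<lambda>_. lborel :: real measure))"
    using assms by (intro null_setsI sets_PiM_I_finite) auto
  show "{t \<in> space (Pi\<^sub>M J (\<lambda>_. lborel :: real measure)). \<not> t p \<noteq> c} \<subseteq> Pi\<^sub>E J ?A"
    by (auto simp: space_PiM PiE_iff extensional_def)
qed

text \<open>Strict inequalities along the generating pairs pass to the transitive closure, and
  distinct elements related by the order are related by that closure.\<close>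

lemma mem_Delta_P:
  assumes t: "t \<in> L ws \<rightarrow>\<^sub>E UNIV"
  shows "t \<in> Delta (P ds ws) \<longleftrightarrow> (\<forall>p\<in>L ws. 0 \<le> t p \<and> t p \<le> 1) \<and> compatible (<) (>) ws t"
proof -
  have cov: "p \<in> L ws \<and> q \<in> L ws \<and> p \<noteq> q" if "(p, q) \<in> covers ws" for p q
    using that by (auto simp: covers_def)
  have compat: "compatible (<) (>) ws t \<longleftrightarrow> (\<forall>p q. (p, q) \<in> covers ws \<longrightarrow> t p < t q)"
    unfolding compatible_def covers_def by blast
  have "t p < t q" if "\<forall>p q. (p, q) \<in> covers ws \<longrightarrow> t p < t q" "(p, q) \<in> (covers ws)\<^sup>+" for p q
    using that(2)
  proof (induction rule: trancl_induct)
    case (base q)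
    with that(1) show ?case by blast
  next
    case (step q q')
    with that(1) have "t q < t q'" by blast
    with step.IH show ?case by simp
  qed
  note trancl = this
  have "compatible (<) (>) ws t \<longleftrightarrow>
      (\<forall>p\<in>L ws. \<forall>q\<in>L ws. (p, q) \<in> (covers ws)\<^sup>* \<inter> L ws \<times> L ws \<and> p \<noteq> q \<longrightarrow> t p < t q)"
    unfolding compat
  proof (intro iffI ballI allI impI)
    fix p q assume c: "\<forall>p q. (p, q) \<in> covers ws \<longrightarrow> t p < t q"
      and "(p, q) \<in> (covers ws)\<^sup>* \<inter> L ws \<times> L ws \<and> p \<noteq> q"
    then have "(p, q) \<in> (covers ws)\<^sup>+"
      by (metis IntD1 rtranclD)
    with c show "t p < t q" by (rule trancl)
  next
    fix p q assume "\<forall>p\<in>L ws. \<forall>q\<in>L ws. (p, q) \<in> (covers ws)\<^sup>* \<inter> L ws \<times> L ws \<and> p \<noteq> q \<longrightarrow> t p < t q"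
      and "(p, q) \<in> covers ws"
    then show "t p < t q"
      using cov[of p q] by (meson IntI SigmaI r_into_rtrancl)
  qed
  then show ?thesis
    using t by (auto simp: Delta_def P_def PiE_iff)
qed

text \<open>On \<open>Delta\<close> the integrand is nonnegative, and it agrees with the weight off
  the null set where some coordinate is 0 or 1. Finiteness of the nonnegative integral then gives
  integrability as well as the value.\<close>

lemma integral_eq_weight_integral:
  assumes fin: "(\<integral>\<^sup>+u. integral_weight ds ws u \<partial>Pi\<^sub>M (L ws) (\<lambda>_. lborel)) = ennreal c"
    and "0 \<le> c" and wp: "weakly_proper ws"
  shows "I_converges (P ds ws)" "Defs.I (P ds ws) = c"
proof -
  let ?M = "Pi\<^sub>M (L ws) (\<lambda>_. lborel :: real measure)"
  let ?D = "Delta (P ds ws)"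
  define F where "F t = indicator ?D t *\<^sub>R integrand (P ds ws) t" for t
  have integrand: "integrand (P ds ws) t = (\<Prod>p\<in>L ws. form_density (ds ! (fst p - 1)) (t p))" for t
    by (simp add: integrand_def P_def case_prod_beta)
  have density_nonneg: "0 \<le> form_density d x" if "0 \<le> x" "x \<le> 1" for d x
    using that by (cases d) auto
  have space: "space ?M = L ws \<rightarrow>\<^sub>E UNIV"
    by (simp add: space_PiM)
  have comp: "(\<lambda>t. t p) \<in> borel_measurable ?M" if "p \<in> L ws" for p
    using measurable_component_singleton[OF that, of "\<lambda>_. lborel :: real measure"] by simp
  have D: "?D \<in> sets ?M"
  proof -
    have box: "Measurable.pred ?M (\<lambda>t. p \<in> L ws \<longrightarrow> 0 \<le> t p \<and> t p \<le> 1)" for p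
    proof (rule pred_const_imp)
      assume "p \<in> L ws"
      note [measurable] = comp[OF this]
      show "Measurable.pred ?M (\<lambda>t. 0 \<le> t p \<and> t p \<le> 1)"
        by measurable
    qed
    have "Measurable.pred ?M (\<lambda>t. (\<forall>p\<in>L ws. 0 \<le> t p \<and> t p \<le> 1) \<and> compatible (<) (>) ws t)"
      unfolding Ball_def by (intro pred_intros_logic(3) pred_intros_countable(1) box pred_compatible pred_less_lborel)
    then have "{t \<in> space ?M. (\<forall>p\<in>L ws. 0 \<le> t p \<and> t p \<le> 1) \<and> compatible (<) (>) ws t} \<in> sets ?M"
      by (rule predE)
    also have "{t \<in> space ?M. (\<forall>p\<in>L ws. 0 \<le> t p \<and> t p \<le> 1) \<and> compatible (<) (>) ws t} = ?D"
    proof -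
      have "t \<in> ?D \<longleftrightarrow> t \<in> space ?M \<and> (\<forall>p\<in>L ws. 0 \<le> t p \<and> t p \<le> 1) \<and> compatible (<) (>) ws t" for t
      proof (cases "t \<in> space ?M")
        case True
        then show ?thesis
          using mem_Delta_P[of t ws ds] unfolding space by simp
      next
        case False
        then show ?thesis
          unfolding space by (auto simp: Delta_def P_def PiE_iff)
      qed
      then show ?thesis by blast
    qed
    finally show ?thesis .
  qed
  have density_measurable: "form_density d \<in> borel_measurable borel" for d
  proof -
    have "form_density d = (case d of White \<Rightarrow> \<lambda>x. 1 / x | Black \<Rightarrow> \<lambda>x. 1 / (1 - x))"
      by (rule ext) (cases d; simp)
    then show ?thesis
      by (cases d) simp_all
  qed
  have F_measurable: "F \<in> borel_measurable ?M"
    unfolding F_def integrand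
    by (intro borel_measurable_scaleR borel_measurable_indicator D borel_measurable_prod measurable_compose[OF comp density_measurable])
  have F_nonneg: "0 \<le> F t" for t
  proof (cases "t \<in> ?D")
    case True
    then have "t \<in> L ws \<rightarrow>\<^sub>E {0..1}" by (simp add: Delta_def P_def)
    then have "0 \<le> integrand (P ds ws) t"
      unfolding integrand by (intro prod_nonneg density_nonneg) (auto simp: PiE_iff)
    then show ?thesis by (simp add: F_def)
  qed (simp add: F_def)
  have "AE t in ?M. \<forall>p\<in>L ws. t p \<noteq> 0 \<and> t p \<noteq> 1"
    using AE_PiM_lborel_neq[OF finite_L[OF wp]] by (subst AE_finite_all[OF finite_L[OF wp]]) auto
  then have "AE t in ?M. ennreal (F t) = integral_weight ds ws t"
    using AE_space
  proof eventually_elim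
    case (elim t)
    show ?case
    proof (cases "compatible (<) (>) ws t \<and> (\<forall>p\<in>L ws. 0 < t p \<and> t p < 1)")
      case True
      then have "t \<in> ?D"
        using mem_Delta_P[of t ws ds] elim(2) unfolding space by (auto simp: less_imp_le)
      moreover have "(\<Prod>p\<in>L ws. form_weight (ds ! (fst p - 1)) (t p)) = ennreal (\<Prod>p\<in>L ws. form_density (ds ! (fst p - 1)) (t p))"
        using True by (subst prod_ennreal[symmetric]) (auto simp: form_weight_def less_imp_le intro!: density_nonneg prod.cong)
      ultimately show ?thesis
        using True by (simp add: F_def integrand weight_def)
    next
      case False
      then have "t \<notin> ?D"
        using mem_Delta_P[of t ws ds] elim unfolding space by (force simp: order.order_iff_strict)
      moreover have "integral_weight ds ws t = 0"
      proof (cases "compatible (<) (>) ws t")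
        case True
        with False obtain p where "p \<in> L ws" "\<not> (0 < t p \<and> t p < 1)" by blast
        then have "(\<Prod>p\<in>L ws. form_weight (ds ! (fst p - 1)) (t p)) = 0"
          using finite_L[OF wp] by (intro prod_zero bexI[of _ p]) (auto simp: form_weight_def)
        then show ?thesis by (simp add: weight_def)
      qed (simp add: weight_def)
      ultimately show ?thesis by (simp add: F_def)
    qed
  qed
  then have nn: "(\<integral>\<^sup>+t. ennreal (F t) \<partial>?M) = ennreal c"
    using fin nn_integral_cong_AE by metis
  have "integrable ?M F"
    by (rule integrableI_nn_integral_finite[OF F_measurable _ nn]) (simp add: F_nonneg)
  then show "I_converges (P ds ws)"
    unfolding I_converges_def set_integrable_def F_def[abs_def] by (simp add: P_def)
  have "integral\<^sup>L ?M F = c"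
    using integral_eq_nn_integral[OF F_measurable] F_nonneg nn \<open>0 \<le> c\<close> by simp
  then show "Defs.I (P ds ws) = c"
    unfolding I_def set_lebesgue_integral_def F_def[abs_def] by (simp add: P_def)
qed

subsection \<open>Convergence\<close>

lemma next_column_up: "y \<in> Y \<Longrightarrow> r \<in> {Up, Op} \<Longrightarrow> y + 1 \<in> next_column r Y"
  by auto

lemma next_column_down: "y \<in> next_column r Y \<Longrightarrow> r \<in> {Down, Cl} \<Longrightarrow> y + 1 \<in> Y"
  by auto

text \<open>The second coordinate grows along these steps, so iterating them ends in a column whose
  exponent is at least 2.\<close>

lemma zeta_index_step:
  assumes adm: "admissible ks rs" and p: "p \<in> L rs" and k: "ks ! (fst p - 1) \<le> 1"
  shows "\<exists>q\<in>L rs. snd q = snd p + 1 \<and> (\<forall>m\<in>zeta_index rs. m p \<le> m q)"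
proof -
  obtain x y where xy: "p = (x, y)" by (cases p)
  have x: "1 \<le> x" "x \<le> length rs + 1" and y: "y \<in> column rs (x - 1)"
    using p by (auto simp: xy L_def)
  have "(x = 1 \<or> rs ! (x - 2) \<in> {Up, Op}) \<and> (x = length rs + 1 \<or> rs ! (x - 1) \<in> {Down, Cl}) \<longrightarrow> ks ! (x - 1) > 1"
    by (rule adm[unfolded admissible_def, THEN bspec]) (use x in simp)
  then have "\<not> ((x = 1 \<or> rs ! (x - 2) \<in> {Up, Op}) \<and> (x = length rs + 1 \<or> rs ! (x - 1) \<in> {Down, Cl}))"
    using k unfolding xy fst_conv by (metis not_less)
  moreover have "r \<in> {Up, Op} \<or> r \<in> {Down, Cl}" for r
    by (cases r) simp_all
  \<comment> \<open>At exponent 1 one of the two conditions in \<open>admissible\<close> fails, and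
    either failure yields a neighbour with larger second coordinate: on the right along
    \<open>Up\<close> or \<open>Op\<close>, or on the left if the column was reached by
    \<open>Down\<close> or \<open>Cl\<close>.\<close>
  ultimately consider "x \<noteq> length rs + 1" "rs ! (x - 1) \<in> {Up, Op}" | "x \<noteq> 1" "rs ! (x - 2) \<in> {Down, Cl}"
    by blast
  then show ?thesis
  proof cases
    case 1
    have "y + 1 \<in> column rs (Suc (x - 1))"
      using next_column_up[OF y 1(2)] by simp
    then have q: "(x + 1, y + 1) \<in> L rs"
      using x 1 by (auto simp: L_def)
    have "m p \<le> m (x + 1, y + 1)" if "m \<in> zeta_index rs" for m
    proof -
      have "\<forall>x y. (x, y) \<in> L rs \<and> (x + 1, y + 1) \<in> L rs \<longrightarrow> m (x, y) < m (x + 1, y + 1)"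
        using that unfolding zeta_index_def by blast
      from this[rule_format, of x y] show ?thesis
        using p q by (simp add: xy)
    qed
    with q show ?thesis
      by (intro bexI[of _ "(x + 1, y + 1)"]) (auto simp: xy)
  next
    case 2
    define z where "z = x - 2"
    have z: "x = Suc (Suc z)" using x 2 by (simp add: z_def)
    have "y + 1 \<in> column rs z"
      using next_column_down[of y "rs ! z" "column rs z"] y 2 by (simp add: z)
    then have q: "(x - 1, y + 1) \<in> L rs"
      using x by (simp add: L_def z)
    have "m p \<le> m (x - 1, y + 1)" if "m \<in> zeta_index rs" for m
    proof -
      have "\<forall>x y. (x, y) \<in> L rs \<and> (x + 1, y - 1) \<in> L rs \<longrightarrow> m (x, y) \<ge> m (x + 1, y - 1)"
        using that unfolding zeta_index_def by blast
      from this[rule_format, of "x - 1" "y + 1"] show ?thesis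
        using p q by (simp add: xy z)
    qed
    with q show ?thesis
      by (intro bexI[of _ "(x - 1, y + 1)"]) (auto simp: xy)
  qed
qed

lemma zeta_index_dominated:
  assumes adm: "admissible ks rs" and wp: "weakly_proper rs" and "p \<in> L rs"
  shows "\<exists>q\<in>L rs. 1 < ks ! (fst q - 1) \<and> (\<forall>m\<in>zeta_index rs. m p \<le> m q)"
  using \<open>p \<in> L rs\<close>
proof (induction "nat (Max (snd ` L rs) - snd p)" arbitrary: p rule: less_induct)
  case less
  show ?case
  proof (cases "1 < ks ! (fst p - 1)")
    case True
    with less.prems show ?thesis by blast
  next
    case False
    then obtain q where q: "q \<in> L rs" "snd q = snd p + 1" "\<forall>m\<in>zeta_index rs. m p \<le> m q"
      using zeta_index_step[OF adm less.prems] by auto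
    have "snd q \<le> Max (snd ` L rs)"
      using finite_L[OF wp] q(1) by (intro Max_ge) auto
    then have "nat (Max (snd ` L rs) - snd q) < nat (Max (snd ` L rs) - snd p)"
      using q(2) by linarith
    from less.hyps[OF this q(1)] show ?thesis
      using q(3) by (meson order_trans)
  qed
qed

text \<open>Every entry with exponent 1 is bounded by an entry with exponent at least 2, hence by the
  product \<open>M\<close> of all of the latter. A total power \<open>M powr (1 / 2)\<close> is therefore enough to raise
  all exponents 1 to \<open>1 + e\<close>, and lowers the other exponents by 1/2 only.\<close>

lemma zeta_converges_admissible:
  assumes adm: "admissible ks rs" and wp: "weakly_proper rs" and pos: "\<forall>k\<in>set ks. 0 < k"
    and len: "length ks = length rs + 1"
  shows "zeta_converges ks rs"
proof -
  define A where "A = {p \<in> L rs. ks ! (fst p - 1) \<le> 1}"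
  define B where "B = L rs - A"
  \<comment> \<open>The entries with exponent 1 need the power \<open>e\<close> each, in total at
    most 1/2; the added 1 covers an empty \<open>A\<close>. Also \<open>e\<close> is at most 1/2, as
    the entries in \<open>B\<close> require.\<close>
  define e where "e = 1 / (2 * (real (card A) + 1))"
  have fin: "finite (L rs)" "finite A" "finite B"
    using finite_L[OF wp] by (simp_all add: A_def B_def)
  have split: "(\<Prod>p\<in>L rs. f p) = (\<Prod>p\<in>A. f p) * (\<Prod>p\<in>B. f p)" for f :: "nat \<times> int \<Rightarrow> real"
    unfolding B_def using prod.subset_diff[of A "L rs" f] fin by (simp add: A_def mult.commute)
  have e: "0 < e" "e * real (card A) \<le> 1 / 2" "e \<le> 1 / 2"
    by (simp_all add: e_def field_simps)
  have bound: "zeta_term ks rs m \<le> (\<Prod>p\<in>L rs. real (m p) powr - (1 + e))" if m: "m \<in> zeta_index rs" for m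
  proof -
    have m1: "1 \<le> real (m p)" if "p \<in> L rs" for p
      using m that by (auto simp: zeta_index_def PiE_iff)
    define M where "M = (\<Prod>q\<in>B. real (m q))"
    have M1: "1 \<le> M"
      unfolding M_def using m1 by (intro prod_ge_1) (auto simp: B_def)
    have le_M: "real (m p) \<le> M" if p: "p \<in> L rs" for p
    proof -
      obtain q where "q \<in> L rs" "1 < ks ! (fst q - 1)" "m p \<le> m q"
        using zeta_index_dominated[OF adm wp p] m by blast
      then have q: "q \<in> B" "m p \<le> m q"
        by (simp_all add: A_def B_def)
      have "M = real (m q) * (\<Prod>q\<in>B - {q}. real (m q))"
        unfolding M_def using q fin by (simp add: prod.remove)
      moreover have "1 \<le> (\<Prod>q\<in>B - {q}. real (m q))"
        using m1 by (intro prod_ge_1) (auto simp: B_def)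
      ultimately have "real (m q) \<le> M"
        using mult_left_mono[of 1 "\<Prod>q\<in>B - {q}. real (m q)" "real (m q)"] by simp
      with q(2) show ?thesis by simp
    qed
    have "(\<Prod>p\<in>A. real (m p) powr e) \<le> (\<Prod>p\<in>A. M powr e)"
      using le_M e(1) by (intro prod_mono conjI powr_mono2) (auto simp: A_def)
    also have "\<dots> = M powr (e * real (card A))"
      using M1 by (simp add: powr_powr[symmetric] powr_realpow)
    also have "\<dots> \<le> M powr (1 / 2)"
      using M1 e(2) by (intro powr_mono) auto
    finally have *: "(\<Prod>p\<in>A. real (m p) powr e) \<le> M powr (1 / 2)" .
    have A_le: "(\<Prod>p\<in>A. real (m p) powr e) * (\<Prod>p\<in>B. real (m p) powr - (1 / 2)) \<le> 1"
    proof -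
      have "(\<Prod>p\<in>B. real (m p) powr - (1 / 2)) = M powr - (1 / 2)"
        unfolding M_def by (rule prod_powr_distrib[symmetric])
      then have "(\<Prod>p\<in>A. real (m p) powr e) * (\<Prod>p\<in>B. real (m p) powr - (1 / 2)) \<le> M powr (1 / 2) * M powr - (1 / 2)"
        using * by (simp add: mult_right_mono)
      also have "\<dots> = 1"
        using M1 by (simp add: powr_add[symmetric])
      finally show ?thesis .
    qed
    have term_eq: "zeta_term ks rs m = (\<Prod>p\<in>L rs. 1 / real (m p) ^ (ks ! (fst p - 1)))"
      by (simp add: zeta_term_def case_prod_beta)
    have on_A: "1 / real (m p) ^ (ks ! (fst p - 1)) = real (m p) powr - (1 + e) * real (m p) powr e" if "p \<in> A" for p
    proof -
      have "fst p - 1 < length ks"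
        using that L_fst[of p rs] len by (auto simp: A_def)
      with pos have "0 < ks ! (fst p - 1)" by simp
      with that have "ks ! (fst p - 1) = 1" by (simp add: A_def)
      moreover have "1 \<le> real (m p)" using that m1 by (simp add: A_def)
      ultimately show ?thesis by (simp add: powr_add[symmetric] powr_minus_divide)
    qed
    have on_B: "1 / real (m p) ^ (ks ! (fst p - 1)) \<le> real (m p) powr - (1 + e) * real (m p) powr - (1 / 2)" if "p \<in> B" for p
    proof -
      have "2 \<le> ks ! (fst p - 1)" and p1: "1 \<le> real (m p)"
        using that m1 by (auto simp: A_def B_def)
      then have "1 / real (m p) ^ (ks ! (fst p - 1)) = real (m p) powr - real (ks ! (fst p - 1))"
        by (simp add: powr_minus_divide powr_realpow)
      \<comment> \<open>Here \<open>1 + e + 1 / 2\<close> is at most 2, hence at most the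
        exponent.\<close>
      also have "\<dots> \<le> real (m p) powr (- (1 + e) + - (1 / 2))"
        using \<open>2 \<le> ks ! (fst p - 1)\<close> p1 e(3) by (intro powr_mono) auto
      finally show ?thesis by (simp only: powr_add)
    qed
    have "zeta_term ks rs m \<le> (\<Prod>p\<in>A. real (m p) powr - (1 + e) * real (m p) powr e) *
        (\<Prod>p\<in>B. real (m p) powr - (1 + e) * real (m p) powr - (1 / 2))"
      unfolding term_eq split using on_A on_B
      by (intro mult_mono prod_mono) (auto intro!: prod_nonneg)
    also have "\<dots> = (\<Prod>p\<in>L rs. real (m p) powr - (1 + e)) *
        ((\<Prod>p\<in>A. real (m p) powr e) * (\<Prod>p\<in>B. real (m p) powr - (1 / 2)))"
      unfolding split prod.distrib by (simp only: mult_ac)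
    also have "\<dots> \<le> (\<Prod>p\<in>L rs. real (m p) powr - (1 + e)) * 1"
      by (intro mult_left_mono A_le prod_nonneg) simp
    finally show ?thesis by simp
  qed
  \<comment> \<open>The bound has the same exponent above 1 for each entry, so its sum over
    unrestricted families is a product of convergent one-variable series.\<close>
  have "Infinite_Set_Sum.abs_summable_on (\<lambda>a. real a powr - (1 + e)) {1..}"
    by (rule abs_summable_on_subset[of _ UNIV])
      (use e(1) in \<open>simp_all add: abs_summable_on_nat_iff' summable_real_powr_iff\<close>)
  then have "Infinite_Set_Sum.abs_summable_on (\<lambda>m. \<Prod>p\<in>L rs. real (m p) powr - (1 + e)) (L rs \<rightarrow>\<^sub>E {1..})"
    by (intro abs_summable_on_prod_PiE fin) auto
  then have "Infinite_Set_Sum.abs_summable_on (\<lambda>m. \<Prod>p\<in>L rs. real (m p) powr - (1 + e)) (zeta_index rs)"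
    by (rule abs_summable_on_subset) (auto simp: zeta_index_def)
  then have "(\<lambda>m. \<Prod>p\<in>L rs. real (m p) powr - (1 + e)) summable_on zeta_index rs"
    by (simp add: abs_summable_equivalent[symmetric] abs_summable_summable)
  then show ?thesis
    unfolding zeta_converges_def
    by (rule summable_on_comparison_test)
      (use bound in \<open>auto simp: zeta_term_def case_prod_beta intro!: prod_nonneg\<close>)
qed

text \<open>Among extensional families the weight vanishes outside \<open>zeta_index\<close>, so the
  integral for the counting measure is the sum over that set. Convergence is what identifies it with
  the real-valued \<open>infsum\<close>.\<close>

lemma series_weight_integral:
  assumes conv: "zeta_converges ks rs" and wp: "weakly_proper rs"
  shows "(\<integral>\<^sup>+m. series_weight ks rs m \<partial>Pi\<^sub>M (L rs) (\<lambda>_. count_space UNIV)) = ennreal (zeta ks rs)"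
proof -
  have abs: "Infinite_Set_Sum.abs_summable_on (zeta_term ks rs) (zeta_index rs)"
    by (rule abs_summable_equivalent[THEN iffD1])
      (rule summable_on_iff_abs_summable_on_real[THEN iffD1, OF conv[unfolded zeta_converges_def]])
  have "(\<integral>\<^sup>+m. series_weight ks rs m \<partial>count_space (L rs \<rightarrow>\<^sub>E UNIV))
      = (\<integral>\<^sup>+m. series_weight ks rs m \<partial>count_space (zeta_index rs))"
  proof (rule nn_integral_count_space_eq)
    fix m assume m: "m \<in> (L rs \<rightarrow>\<^sub>E UNIV) - zeta_index rs"
    show "series_weight ks rs m = 0"
    proof (rule ccontr)
      assume nz: "series_weight ks rs m \<noteq> 0"
      then have "compatible (<) (\<ge>) rs m" by (auto simp: weight_def)
      moreover have "m \<in> L rs \<rightarrow>\<^sub>E {1..}"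
        using m series_weight_nonzero(1)[OF wp nz] by (auto simp: PiE_iff Suc_le_eq)
      ultimately show False
        using m by (simp add: zeta_index_def compatible_def)
    qed
  qed (auto simp: zeta_index_def PiE_iff)
  also have "\<dots> = (\<integral>\<^sup>+m. ennreal (zeta_term ks rs m) \<partial>count_space (zeta_index rs))"
  proof (rule nn_integral_cong)
    fix m assume "m \<in> space (count_space (zeta_index rs))"
    then have m: "m \<in> zeta_index rs" by simp
    then have "compatible (<) (\<ge>) rs m"
      by (simp add: zeta_index_def compatible_def)
    moreover have pos: "0 < m p" if "p \<in> L rs" for p
      using m that by (auto simp: zeta_index_def PiE_iff Suc_le_eq)
    moreover have "(\<Prod>p\<in>L rs. inverse_power (ks ! (fst p - 1)) (m p)) = ennreal (zeta_term ks rs m)"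
      unfolding zeta_term_def using pos
      by (subst prod_ennreal[symmetric]) (auto simp: inverse_power_def case_prod_beta intro!: prod.cong)
    ultimately show "series_weight ks rs m = ennreal (zeta_term ks rs m)"
      by (simp add: weight_def)
  qed
  also have "\<dots> = ennreal (infsetsum (zeta_term ks rs) (zeta_index rs))"
    by (rule nn_integral_conv_infsetsum[OF abs]) (auto simp: zeta_term_def case_prod_beta intro!: prod_nonneg)
  also have "infsetsum (zeta_term ks rs) (zeta_index rs) = zeta ks rs"
    unfolding zeta_def by (rule infsetsum_infsum[OF abs])
  finally show ?thesis
    by (simp add: PiM_count_space finite_L[OF wp])
qed

theorem theorem2p5:
  fixes s :: nat and ks :: "nat list" and rs :: "step list"
  assumes "length ks = s + 1" and "length rs = s"
    and "\<forall>k\<in>set ks. k > 0"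
    and "proper rs"
    and "admissible ks rs"
  shows "zeta_converges ks rs \<and>
         I_converges (P (word_marks ks) (word_steps ks rs)) \<and>
         zeta ks rs = I (P (word_marks ks) (word_steps ks rs))"
proof -
  have wp: "weakly_proper rs" and len: "length ks = length rs + 1"
    using assms by (simp_all add: proper_def)
  have conv: "zeta_converges ks rs"
    by (rule zeta_converges_admissible[OF assms(5) wp assms(3) len])
  have rep: "represents ks rs (word_marks ks) (word_steps ks rs)"
    by (rule represents_word[OF wp len assms(3)])
  have "(\<integral>\<^sup>+u. integral_weight (word_marks ks) (word_steps ks rs) u \<partial>Pi\<^sub>M (L (word_steps ks rs)) (\<lambda>_. lborel))
      = ennreal (zeta ks rs)"
    using integral_weight_eq_series_weight[OF rep assms(4)] series_weight_integral[OF conv wp] by simp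
  moreover have "0 \<le> zeta ks rs"
    unfolding zeta_def by (intro infsum_nonneg) (auto simp: zeta_term_def case_prod_beta intro!: prod_nonneg)
  moreover have "weakly_proper (word_steps ks rs)"
    using rep by (simp add: represents_def)
  ultimately show ?thesis
    using conv integral_eq_weight_integral by metis
qed

end
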